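(* Let $\nu$ be an infinite cardinal with $\nu=\nu^{<\nu}$ and let $\kappa=\nu^+=2^\nu$. Assume that every $\kappa$-Aronszajn tree that does not contain a $\kappa$-Souslin subtree is special. Then there is a $\mathbf{\Delta}^1_1$-subset of ${}^\kappa\kappa$ that does not have the $\kappa$-Baire property.
   Context: ${}^\kappa\kappa$ is the set of functions $\kappa\to\kappa$, with the topology whose basic open sets are $N_s=\{x\in{}^\kappa\kappa : s\subseteq x\}$ for $s$ a function from some ordinal $\alpha<\kappa$ to $\kappa$. A subset of ${}^\kappa\kappa$ is $\mathbf{\Sigma}^1_1$ if it is the projection onto the first coordinate of a closed subset of ${}^\kappa\kappa\times{}^\kappa\kappa$, and $\mathbf{\Delta}^1_1$ if both it and its complement are $\mathbf{\Sigma}^1_1$. A set $A\subseteq{}^\kappa\kappa$ has the $\kappa$-Baire property if there are an open $U$ and nowhere dense sets $N_\alpha$ ($\alpha<\kappa$) with the symmetric difference of $A$ and $U$ contained in $\bigcup_{\alpha<\kappa}N_\alpha$. A $\kappa$-Aronszajn tree is a tree of height $\kappa$ with no branch of length $\kappa$ all of whose levels have cardinality less than $\kappa$; it is a $\kappa$-Souslin tree if moreover all its antichains have cardinality less than $\kappa$. A tree $T$ of height $\nu^+$ is special if there is a function $s:T\to\nu$ that is injective on chains of $T$. *)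

theory Defs
  imports Main
begin

definition tpred :: "('a \<times> 'a) set \<Rightarrow> 'a \<Rightarrow> 'a set" where
  "tpred lt t = {s. (s, t) \<in> lt}"

definition htrel :: "('a \<times> 'a) set \<Rightarrow> 'a \<Rightarrow> ('a \<times> 'a) set" where
  "htrel lt t = Restr (lt\<^sup>=) (tpred lt t)"

definition is_tree :: "'a set \<Rightarrow> ('a \<times> 'a) set \<Rightarrow> bool" where
  "is_tree T lt \<longleftrightarrow> lt \<subseteq> T \<times> T \<and> trans lt \<and> (\<forall>t. (t, t) \<notin> lt)
     \<and> (\<forall>t\<in>T. Well_order (htrel lt t))"

definition is_chain :: "('a \<times> 'a) set \<Rightarrow> 'a set \<Rightarrow> bool" where
  "is_chain lt C \<longleftrightarrow> (\<forall>a\<in>C. \<forall>b\<in>C. a = b \<or> (a, b) \<in> lt \<or> (b, a) \<in> lt)"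

definition is_antichain :: "('a \<times> 'a) set \<Rightarrow> 'a set \<Rightarrow> bool" where
  "is_antichain lt A \<longleftrightarrow> (\<forall>a\<in>A. \<forall>b\<in>A. a \<noteq> b \<longrightarrow> (a, b) \<notin> lt \<and> (b, a) \<notin> lt)"

text \<open>kappa is represented by a cardinal order r (an initial ordinal) on a type 'k; the ordinal
alpha < kappa is represented by the element x with initial segment underS r x.
The alpha-th level: nodes whose predecessor set has order type alpha.\<close>

definition tlevel :: "('k \<times> 'k) set \<Rightarrow> 'a set \<Rightarrow> ('a \<times> 'a) set \<Rightarrow> 'k \<Rightarrow> 'a set" where
  "tlevel r T lt x = {t \<in> T. ordIso2 (htrel lt t) (Restr r (underS r x))}"

definition height_kappa_tree :: "('k \<times> 'k) set \<Rightarrow> 'a set \<Rightarrow> ('a \<times> 'a) set \<Rightarrow> bool" where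
  "height_kappa_tree r T lt \<longleftrightarrow> is_tree T lt
     \<and> (\<forall>t\<in>T. ordLess2 (htrel lt t) r) \<and> (\<forall>x. tlevel r T lt x \<noteq> {})"

definition kappa_aronszajn :: "('k \<times> 'k) set \<Rightarrow> 'a set \<Rightarrow> ('a \<times> 'a) set \<Rightarrow> bool" where
  "kappa_aronszajn r T lt \<longleftrightarrow> height_kappa_tree r T lt
     \<and> (\<forall>x. ordLess2 (card_of (tlevel r T lt x)) r)
     \<and> \<not> (\<exists>B \<subseteq> T. is_chain lt B \<and> ordIso2 (Restr (lt\<^sup>=) B) r)"

definition kappa_souslin :: "('k \<times> 'k) set \<Rightarrow> 'a set \<Rightarrow> ('a \<times> 'a) set \<Rightarrow> bool" where
  "kappa_souslin r T lt \<longleftrightarrow> kappa_aronszajn r T lt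
     \<and> (\<forall>A \<subseteq> T. is_antichain lt A \<longrightarrow> ordLess2 (card_of A) r)"

definition Nb :: "('k \<times> 'k) set \<Rightarrow> 'k \<Rightarrow> ('k \<Rightarrow> 'k) \<Rightarrow> ('k \<Rightarrow> 'k) set" where
  "Nb r x f = {g. \<forall>y \<in> underS r x. g y = f y}"

definition kopen :: "('k \<times> 'k) set \<Rightarrow> ('k \<Rightarrow> 'k) set \<Rightarrow> bool" where
  "kopen r U \<longleftrightarrow> (\<forall>f\<in>U. \<exists>x. Nb r x f \<subseteq> U)"

definition kopen2 :: "('k \<times> 'k) set \<Rightarrow> (('k \<Rightarrow> 'k) \<times> ('k \<Rightarrow> 'k)) set \<Rightarrow> bool" where
  "kopen2 r W \<longleftrightarrow> (\<forall>(f, g)\<in>W. \<exists>x1 x2. Nb r x1 f \<times> Nb r x2 g \<subseteq> W)"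

definition kclosed2 :: "('k \<times> 'k) set \<Rightarrow> (('k \<Rightarrow> 'k) \<times> ('k \<Rightarrow> 'k)) set \<Rightarrow> bool" where
  "kclosed2 r C \<longleftrightarrow> kopen2 r (- C)"

definition Sigma11 :: "('k \<times> 'k) set \<Rightarrow> ('k \<Rightarrow> 'k) set \<Rightarrow> bool" where
  "Sigma11 r A \<longleftrightarrow> (\<exists>C. kclosed2 r C \<and> A = fst ` C)"

definition Delta11 :: "('k \<times> 'k) set \<Rightarrow> ('k \<Rightarrow> 'k) set \<Rightarrow> bool" where
  "Delta11 r A \<longleftrightarrow> Sigma11 r A \<and> Sigma11 r (- A)"

definition kinterior :: "('k \<times> 'k) set \<Rightarrow> ('k \<Rightarrow> 'k) set \<Rightarrow> ('k \<Rightarrow> 'k) set" where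
  "kinterior r A = {f. \<exists>x. Nb r x f \<subseteq> A}"

definition kclosure :: "('k \<times> 'k) set \<Rightarrow> ('k \<Rightarrow> 'k) set \<Rightarrow> ('k \<Rightarrow> 'k) set" where
  "kclosure r A = - kinterior r (- A)"

definition nowhere_dense :: "('k \<times> 'k) set \<Rightarrow> ('k \<Rightarrow> 'k) set \<Rightarrow> bool" where
  "nowhere_dense r N \<longleftrightarrow> kinterior r (kclosure r N) = {}"

definition kappa_baire :: "('k \<times> 'k) set \<Rightarrow> ('k \<Rightarrow> 'k) set \<Rightarrow> bool" where
  "kappa_baire r A \<longleftrightarrow> (\<exists>U (N :: 'k \<Rightarrow> ('k \<Rightarrow> 'k) set). kopen r U \<and> (\<forall>a. nowhere_dense r (N a))
      \<and> (A - U) \<union> (U - A) \<subseteq> (\<Union>a. N a))"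

end

theory Submission
  imports Defs
begin

text \<open>
To \<open>x \<in> \<^sup>\<kappa>\<kappa>\<close> we attach a tree with levels of size at most \<open>\<nu>\<close>. Its nodes are sequences that usually follow a
coherent family of \<open>< \<nu>\<close>-to-one functions, the special Aronszajn tree provided by \<open>\<nu>\<^sup><\<^sup>\<nu> = \<nu>\<close>, and that may
jump at \<open>c\<close> only if \<open>x c\<close> is a code for the whole sequence up to \<open>c\<close>. Thus every level has at most one jumping
node, and the jumps of a sequence form a closed set. If a Souslin tree sat inside the tree of \<open>x\<close>, jumping
nodes would be dense in it, so on a club of levels its only node would be the jumping one; these
nodes form a cofinal branch. Hence a tree without cofinal branch is Aronszajn without Souslin subtree, so
it is special by hypothesis. Having a cofinal branch and being special are complementary
\<open>\<Sigma>\<^sup>1\<^sub>1\<close> properties of \<open>x\<close>.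

As in Halko and Shelah's argument for the club filter, a construction of length \<open>\<kappa>\<close> that meets
\<open>\<kappa>\<close> dense open sets leaves the values of \<open>x\<close> on a club free. Letting them code the past yields a
branch, letting them code nothing relevant excludes one, so neither the set of \<open>x\<close> with a branch nor its complement is
meagre in any open set.
\<close>

unbundle cardinal_syntax

subsection \<open>Cardinal arithmetic\<close>

text \<open>The pairs in \<open>nu_less\<close> are the functions from proper initial segments of
  \<nu> to \<nu>, tagged with their length and extended by the dummy value \<open>undefined\<close>;
  so the assumption says \<open>\<nu>\<^sup><\<^sup>\<nu> = \<nu>\<close>.\<close>

locale nu_kappa =
  fixes rn :: "('n \<times> 'n) set" and r :: "('k \<times> 'k) set"
  assumes nu_card: "card_order rn"
    and nu_inf: "infinite (UNIV :: 'n set)"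
    and nu_less: "|{(x, f :: 'n \<Rightarrow> 'n). \<forall>y. y \<notin> underS rn x \<longrightarrow> f y = undefined}| =o |UNIV :: 'n set|"
    and kappa_card: "card_order r"
    and kappa_succ: "r =o cardSuc rn"
    and kappa_pow: "|UNIV :: 'k set| =o |UNIV :: 'n set set|"
begin

abbreviation lt_nu :: "'b set \<Rightarrow> bool" where
  "lt_nu D \<equiv> |D| <o rn"

abbreviation le_nu :: "'b set \<Rightarrow> bool" where
  "le_nu D \<equiv> |D| \<le>o rn"

definition kle :: "'k \<Rightarrow> 'k \<Rightarrow> bool" (infix \<open>\<preceq>\<close> 50) where
  "a \<preceq> b \<longleftrightarrow> (a, b) \<in> r"

definition kless :: "'k \<Rightarrow> 'k \<Rightarrow> bool" (infix \<open>\<prec>\<close> 50) where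
  "a \<prec> b \<longleftrightarrow> (a, b) \<in> r \<and> a \<noteq> b"

definition nle :: "'n \<Rightarrow> 'n \<Rightarrow> bool" (infix \<open>\<sqsubseteq>\<close> 50) where
  "a \<sqsubseteq> b \<longleftrightarrow> (a, b) \<in> rn"

definition nless :: "'n \<Rightarrow> 'n \<Rightarrow> bool" (infix \<open>\<sqsubset>\<close> 50) where
  "a \<sqsubset> b \<longleftrightarrow> (a, b) \<in> rn \<and> a \<noteq> b"

lemma wo_r: "well_order_on UNIV r" and wo_rn: "well_order_on UNIV rn"
  using kappa_card nu_card by (auto simp: card_order_on_def)

lemma Field_r [simp]: "Field r = UNIV" and Field_rn [simp]: "Field rn = UNIV"
  using well_order_on_Field[OF wo_r] well_order_on_Field[OF wo_rn] by simp_all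

lemma Card_r: "Card_order r" and Card_rn: "Card_order rn"
  using kappa_card nu_card by simp_all

lemma Well_r: "Well_order r" and Well_rn: "Well_order rn"
  using wo_r wo_rn by simp_all

lemma r_iso: "r =o |UNIV :: 'k set|" and rn_iso: "rn =o |UNIV :: 'n set|"
  using kappa_card nu_card by (simp_all add: card_of_unique)

end

lemma class_wellorder_of_well_order_on:
  assumes "well_order_on UNIV s"
  shows "class.wellorder (\<lambda>a b. (a, b) \<in> s) (\<lambda>a b. (a, b) \<in> s \<and> a \<noteq> b)"
proof -
  have lin: "linear_order_on UNIV s" and wf: "wf (s - Id)"
    using assms by (auto simp: well_order_on_def)
  have refl: "(a, a) \<in> s" for a
    using lin by (auto simp: order_on_defs refl_on_def)
  have tr: "(a, c) \<in> s" if "(a, b) \<in> s" "(b, c) \<in> s" for a b c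
    using lin that by (auto simp: order_on_defs trans_def)
  have as: "a = b" if "(a, b) \<in> s" "(b, a) \<in> s" for a b
    using lin that by (auto simp: order_on_defs antisym_def)
  have tot: "(a, b) \<in> s \<or> (b, a) \<in> s" for a b
    using lin refl[of a] by (cases "a = b") (auto simp: order_on_defs total_on_def)
  show ?thesis
  proof
    show "P a" if "\<And>x. (\<And>y. (y, x) \<in> s \<and> y \<noteq> x \<Longrightarrow> P y) \<Longrightarrow> P x" for P a
      using wf
      by (induction a rule: wf_induct_rule) (use that in auto)
  qed (use refl tr as tot in blast)+
qed

context nu_kappa
begin

sublocale k: wellorder kle kless
  using class_wellorder_of_well_order_on[OF wo_r]
  by (simp add: kle_def[abs_def] kless_def[abs_def])

sublocale n: wellorder nle nless
  using class_wellorder_of_well_order_on[OF wo_rn]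
  by (simp add: nle_def[abs_def] nless_def[abs_def])

lemma underS_r: "underS r a = {b. b \<prec> a}" and underS_rn: "underS rn x = {y. y \<sqsubset> x}"
  by (auto simp: underS_def kless_def nless_def)

lemma wf_kless: "wf {(a, b). a \<prec> b}"
  using k.wf by (simp add: wfp_def)

text \<open>Since \<kappa> is the successor of \<nu>, smallness below \<kappa> can be expressed by
  \<open>le_nu\<close> from here on.\<close>

lemma less_nu_iff: "|D| <o r \<longleftrightarrow> le_nu D"
proof -
  have "|D| <o r \<longleftrightarrow> |D| <o cardSuc rn"
    using kappa_succ by (meson ordIso_symmetric ordLess_ordIso_trans)
  also have "\<dots> \<longleftrightarrow> |D| \<le>o rn"
    by (rule cardSuc_ordLeq_ordLess[OF Card_rn card_of_Card_order])
  finally show ?thesis .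
qed

lemma not_le_nu_UNIV: "\<not> le_nu (UNIV :: 'k set)"
  using less_nu_iff[of "UNIV :: 'k set"] r_iso
  by (metis not_ordLess_ordIso ordIso_symmetric)

lemma le_nu_iff: "le_nu D \<longleftrightarrow> |D| \<le>o |UNIV :: 'n set|"
  and lt_nu_iff: "lt_nu D \<longleftrightarrow> |D| <o |UNIV :: 'n set|"
  using rn_iso ordIso_symmetric[OF rn_iso]
  by (meson ordLeq_ordIso_trans ordLess_ordIso_trans)+

lemma lt_nu_le_nu: "lt_nu D \<Longrightarrow> le_nu D"
  by (rule ordLess_imp_ordLeq)

lemma le_nu_subset: "A \<subseteq> B \<Longrightarrow> le_nu B \<Longrightarrow> le_nu A"
  using card_of_mono1 ordLeq_transitive by blast

lemma lt_nu_subset: "A \<subseteq> B \<Longrightarrow> lt_nu B \<Longrightarrow> lt_nu A"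
  using card_of_mono1 ordLeq_ordLess_trans by blast

lemma le_nu_image: "le_nu A \<Longrightarrow> le_nu (f ` A)"
  using card_of_image ordLeq_transitive by blast

lemma lt_nu_image: "lt_nu A \<Longrightarrow> lt_nu (f ` A)"
  using card_of_image ordLeq_ordLess_trans by blast

lemma le_nu_UN: "le_nu I \<Longrightarrow> (\<And>i. i \<in> I \<Longrightarrow> le_nu (A i)) \<Longrightarrow> le_nu (\<Union>i\<in>I. A i)"
  unfolding le_nu_iff using nu_inf by (auto intro: card_of_UNION_ordLeq_infinite)

lemma le_nu_Un: "le_nu A \<Longrightarrow> le_nu B \<Longrightarrow> le_nu (A \<union> B)"
  by (rule card_of_Un_ordLeq_infinite_Field) (simp_all add: nu_inf nu_card)

lemma lt_nu_Un: "lt_nu A \<Longrightarrow> lt_nu B \<Longrightarrow> lt_nu (A \<union> B)"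
  by (rule card_of_Un_ordLess_infinite_Field) (simp_all add: nu_inf nu_card)

lemma lt_nu_finite: "finite A \<Longrightarrow> lt_nu A"
  unfolding lt_nu_iff by (rule finite_ordLess_infinite) (simp_all add: card_of_well_order_on nu_inf Field_card_of)

lemma le_nu_Times: "le_nu A \<Longrightarrow> le_nu B \<Longrightarrow> le_nu (A \<times> B)"
  by (rule card_of_Times_ordLeq_infinite_Field) (simp_all add: nu_inf nu_card)

lemma le_nu_UNIV: "le_nu (UNIV :: 'n set)"
  unfolding le_nu_iff by (rule card_of_mono1) simp

lemma le_nu_below: "le_nu {b. b \<prec> a}"
  using card_of_underS[OF Card_r, of a] by (simp add: less_nu_iff underS_r)

lemma le_nu_atMost: "le_nu {b. b \<preceq> a}"
proof -
  have "{b. b \<preceq> a} = {b. b \<prec> a} \<union> {a}"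
    by (auto simp: k.le_less)
  then show ?thesis
    using le_nu_Un[OF le_nu_below[of a] lt_nu_le_nu[OF lt_nu_finite[of "{a}"]]] by simp
qed

lemma lt_nu_below: "lt_nu {y. y \<sqsubset> x}"
  using card_of_underS[OF Card_rn, of x] by (simp add: underS_rn)

lemma lt_nu_atMost: "lt_nu {y. y \<sqsubseteq> x}"
proof -
  have "{b. b \<sqsubseteq> x} = {b. b \<sqsubset> x} \<union> {x}"
    by (auto simp: n.le_less)
  then show ?thesis
    using lt_nu_Un[OF lt_nu_below[of x] lt_nu_finite[of "{x}"]] by simp
qed

section \<open>Regularity of \<kappa> and \<nu>\<close>

lemma nless_ex: "\<exists>y. x \<sqsubset> y"
  using infinite_Card_order_limit[OF Card_rn, of x] nu_inf by (auto simp: nless_def)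

text \<open>Otherwise \<kappa> would be a union of at most \<nu> initial segments, each of size at
  most \<nu>.\<close>

lemma k_bounded:
  assumes "le_nu D"
  shows "\<exists>b. \<forall>d\<in>D. d \<prec> b"
proof (rule ccontr)
  assume "\<not> ?thesis"
  then have "UNIV = (\<Union>d\<in>D. {b. b \<preceq> d})"
    by (auto simp: k.not_less)
  moreover have "le_nu (\<Union>d\<in>D. {b. b \<preceq> d})"
    using assms le_nu_atMost by (rule le_nu_UN)
  ultimately show False
    using not_le_nu_UNIV by simp
qed

lemma kless_ex: "\<exists>b. a \<prec> b"
  using k_bounded[of "{a}"] lt_nu_le_nu[OF lt_nu_finite, of "{a}"] by auto

text \<open>\<open>\<nu>\<^sup><\<^sup>\<nu> = \<nu>\<close> makes \<open>\<nu>\<close> regular: diagonalise against an enumeration of the functions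
  defined on a hypothetical short cofinal set.\<close>

lemma n_bounded:
  fixes D :: "'n set"
  assumes "lt_nu D"
  shows "\<exists>x. \<forall>d\<in>D. d \<sqsubset> x"
proof (rule ccontr)
  assume unb: "\<not> ?thesis"
  let ?P = "{(x, f :: 'n \<Rightarrow> 'n). \<forall>y. y \<notin> underS rn x \<longrightarrow> f y = undefined}"
  obtain x0 where "|D| =o Restr rn (underS rn x0)"
    using assms ordLess_iff_ordIso_Restr[OF Well_rn card_of_Well_order] by blast
  then have "|Field |D|| =o |Field (Restr rn (underS rn x0))|"
    by (rule card_of_cong)
  moreover have "Field (Restr rn (underS rn x0)) = underS rn x0"
    by (auto simp: Field_def underS_def nle_def[symmetric])
  ultimately have "|D| =o |underS rn x0|"
    by (simp add: Field_card_of)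
  then obtain p where p: "bij_betw p D (underS rn x0)"
    using card_of_ordIso by blast
  obtain \<Phi> where \<Phi>: "bij_betw \<Phi> (UNIV :: 'n set) ?P"
    using nu_less ordIso_symmetric card_of_ordIso by blast
  have "\<exists>v. v \<notin> (\<lambda>a. snd (\<Phi> a) (p d)) ` {a. a \<sqsubset> d}" for d
  proof -
    have "lt_nu ((\<lambda>a. snd (\<Phi> a) (p d)) ` {a. a \<sqsubset> d})"
      using lt_nu_below by (rule lt_nu_image)
    then show ?thesis
      using ordLess_irreflexive lt_nu_iff by (metis UNIV_eq_I)
  qed
  then obtain v where v: "\<And>d. v d \<notin> (\<lambda>a. snd (\<Phi> a) (p d)) ` {a. a \<sqsubset> d}"
    by metis
  define f where "f y = (if y \<in> underS rn x0 then v (inv_into D p y) else undefined)" for y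
  have "(x0, f) \<in> ?P"
    by (simp add: f_def)
  then have "(x0, f) \<in> range \<Phi>"
    using bij_betw_imp_surj_on[OF \<Phi>] by blast
  then obtain a where a: "\<Phi> a = (x0, f)"
    by auto
  \<comment> \<open>As \<open>D\<close> is unbounded, some \<open>d\<close> in it exceeds the index
    \<open>a\<close> of the diagonal function, which contradicts the choice of
    \<open>v d\<close>.\<close>
  obtain b where "a \<sqsubset> b"
    using nless_ex by blast
  moreover obtain d where d: "d \<in> D" "\<not> d \<sqsubset> b"
    using unb by blast
  ultimately have "a \<sqsubset> d"
    by (meson n.not_less n.less_le_trans)
  moreover have "snd (\<Phi> a) (p d) = v d"
    using bij_betwE[OF p] bij_betw_inv_into_left[OF p] d(1) by (simp add: a f_def)
  ultimately show False
    using v[of d] by force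
qed

lemma regular_nu: "regularCard rn"
proof -
  have "|K| =o rn" if K: "cofinal K rn" for K
  proof -
    have "\<not> lt_nu K"
    proof
      assume "lt_nu K"
      then obtain x where x: "\<forall>d\<in>K. d \<sqsubset> x"
        using n_bounded by blast
      obtain b where "b \<in> K" "x \<sqsubset> b"
        using K by (auto simp: cofinal_def nless_def)
      then show False
        using x by (meson n.less_asym)
    qed
    moreover have "le_nu K"
      using le_nu_subset[OF subset_UNIV le_nu_UNIV] .
    ultimately show ?thesis
      by (meson ordLeq_iff_ordLess_or_ordIso)
  qed
  then show ?thesis
    by (simp add: regularCard_def)
qed

lemma lt_nu_UN: "lt_nu I \<Longrightarrow> (\<And>i. i \<in> I \<Longrightarrow> lt_nu (A i)) \<Longrightarrow> lt_nu (\<Union>i\<in>I. A i)"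
  by (rule regularCard_UNION_bound) (auto simp: cinfinite_def nu_inf regular_nu nu_card)

subsection \<open>A coherent family of functions\<close>

text \<open>Fixed for every \<open>b\<close> by choice; it drives the walks below and later turns
  bounded sequences into subsets of \<nu>. The segment includes \<open>b\<close> because sequences
  have a value at their top.\<close>

definition idx :: "'k \<Rightarrow> 'k \<Rightarrow> 'n" where
  "idx b = (SOME f. inj_on f {a. a \<preceq> b})"

lemma inj_on_idx: "inj_on (idx b) {a. a \<preceq> b}"
proof -
  have "\<exists>f :: 'k \<Rightarrow> 'n. inj_on f {a. a \<preceq> b}"
    using le_nu_atMost[of b] unfolding le_nu_iff card_of_ordLeq[symmetric] by blast
  then show ?thesis
    unfolding idx_def by (rule someI_ex)
qed

lemma lt_nu_idx: "lt_nu {d. d \<prec> b \<and> idx b d \<sqsubseteq> i}"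
proof -
  have "inj_on (idx b) {d. d \<prec> b \<and> idx b d \<sqsubseteq> i}"
    by (rule inj_on_subset[OF inj_on_idx]) auto
  moreover have "idx b ` {d. d \<prec> b \<and> idx b d \<sqsubseteq> i} \<subseteq> {y. y \<sqsubseteq> i}"
    by auto
  ultimately have "|{d. d \<prec> b \<and> idx b d \<sqsubseteq> i}| \<le>o |{y. y \<sqsubseteq> i}|"
    using card_of_ordLeq by blast
  then show ?thesis
    using lt_nu_atMost by (rule ordLeq_ordLess_trans)
qed

text \<open>The first step of the walk from \<open>b\<close> down to \<open>a\<close>. It plays the
  part of the least element of a ladder \<open>C\<^sub>b\<close> not below \<open>a\<close>, with
  least index in place of a ladder.\<close>

definition step :: "'k \<Rightarrow> 'k \<Rightarrow> 'k" where
  "step b a = (SOME d. a \<preceq> d \<and> d \<prec> b \<and> (\<forall>d'. a \<preceq> d' \<and> d' \<prec> b \<longrightarrow> idx b d \<sqsubseteq> idx b d'))"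

lemma step:
  assumes "a \<prec> b"
  shows "a \<preceq> step b a" "step b a \<prec> b" "\<And>d. a \<preceq> d \<Longrightarrow> d \<prec> b \<Longrightarrow> idx b (step b a) \<sqsubseteq> idx b d"
proof -
  have "\<exists>i d. a \<preceq> d \<and> d \<prec> b \<and> idx b d = i"
    using assms by auto
  then obtain i where i: "\<exists>d. a \<preceq> d \<and> d \<prec> b \<and> idx b d = i"
      "\<And>j. j \<sqsubset> i \<Longrightarrow> \<not> (\<exists>d. a \<preceq> d \<and> d \<prec> b \<and> idx b d = j)"
    using n.exists_least_iff[of "\<lambda>i. \<exists>d. a \<preceq> d \<and> d \<prec> b \<and> idx b d = i"] by blast
  then have "\<exists>d. a \<preceq> d \<and> d \<prec> b \<and> (\<forall>d'. a \<preceq> d' \<and> d' \<prec> b \<longrightarrow> idx b d \<sqsubseteq> idx b d')"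
    by (metis n.not_less)
  from someI_ex[OF this]
  show "a \<preceq> step b a" "step b a \<prec> b" "\<And>d. a \<preceq> d \<Longrightarrow> d \<prec> b \<Longrightarrow> idx b (step b a) \<sqsubseteq> idx b d"
    unfolding step_def by blast+
qed

text \<open>The recursion is that of Todorcevic's maximal weight \<open>\<rho>\<^sub>1\<close>, with \<open>idx b (step b a)\<close> in place of
  the order type of \<open>C\<^sub>b \<inter> a\<close>.\<close>

lemma ex_weight:
  "\<exists>e :: 'k \<Rightarrow> 'k \<Rightarrow> 'n. \<forall>b a. a \<prec> b \<longrightarrow>
     e b a = (if idx b (step b a) \<sqsubseteq> e (step b a) a then e (step b a) a else idx b (step b a))"
proof -
  define P where "P e b w \<longleftrightarrow> (\<forall>a. a \<prec> b \<longrightarrow>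
     w a = (if idx b (step b a) \<sqsubseteq> e (step b a) a then e (step b a) a else idx b (step b a)))"
    for e :: "'k \<Rightarrow> 'k \<Rightarrow> 'n" and b and w :: "'k \<Rightarrow> 'n"
  have "\<exists>e. \<forall>b. P e b (e b)"
  proof (rule dependent_wf_choice[OF wf_kless])
    show "P f x w = P g x w" if "\<And>z. (z, x) \<in> {(a, b). a \<prec> b} \<Longrightarrow> f z = g z" for f g x w
    proof -
      have "f (step x a) = g (step x a)" if "a \<prec> x" for a
        using \<open>\<And>z. (z, x) \<in> {(a, b). a \<prec> b} \<Longrightarrow> f z = g z\<close> step(2)[OF that] by simp
      then show ?thesis
        unfolding P_def by metis
    qed
    show "\<exists>w. P f x w" for f x
      by (rule exI[of _ "\<lambda>a. if idx x (step x a) \<sqsubseteq> f (step x a) a then f (step x a) a else idx x (step x a)"])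
        (simp add: P_def)
  qed
  then show ?thesis
    unfolding P_def .
qed

definition wt :: "'k \<Rightarrow> 'k \<Rightarrow> 'n" where
  "wt = (SOME e. \<forall>b a. a \<prec> b \<longrightarrow>
     e b a = (if idx b (step b a) \<sqsubseteq> e (step b a) a then e (step b a) a else idx b (step b a)))"

lemma wt:
  "a \<prec> b \<Longrightarrow> wt b a = (if idx b (step b a) \<sqsubseteq> wt (step b a) a then wt (step b a) a else idx b (step b a))"
  using someI_ex[OF ex_weight, folded wt_def] by blast

text \<open>The weight dominates every index met on the walk. If it is at most \<open>i\<close>, the
  first step is one of fewer than \<nu> points of index at most \<open>i\<close>; induction and
  regularity of \<nu> do the rest.\<close>

lemma wt_fibres: "lt_nu {a. a \<prec> b \<and> wt b a \<sqsubseteq> i}"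
proof (induction b rule: k.less_induct)
  case (less b)
  let ?D = "{d. d \<prec> b \<and> idx b d \<sqsubseteq> i}"
  \<comment> \<open>Each \<open>d\<close> is added separately because the recursion says nothing
    about \<open>wt d d\<close>.\<close>
  have "{a. a \<prec> b \<and> wt b a \<sqsubseteq> i} \<subseteq> (\<Union>d\<in>?D. {a. a \<prec> d \<and> wt d a \<sqsubseteq> i} \<union> {d})"
  proof
    fix a assume "a \<in> {a. a \<prec> b \<and> wt b a \<sqsubseteq> i}"
    then have a: "a \<prec> b" "wt b a \<sqsubseteq> i"
      by auto
    let ?d = "step b a"
    have "idx b ?d \<sqsubseteq> i" "wt ?d a \<sqsubseteq> i"
      using a(2) by (auto simp: wt[OF a(1)] split: if_splits dest: n.order_trans n.less_imp_le)
    moreover have "a \<prec> ?d \<or> a = ?d"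
      using step(1)[OF a(1)] k.le_less by blast
    ultimately show "a \<in> (\<Union>d\<in>?D. {a. a \<prec> d \<and> wt d a \<sqsubseteq> i} \<union> {d})"
      using step(2)[OF a(1)] by blast
  qed
  moreover have "lt_nu (\<Union>d\<in>?D. {a. a \<prec> d \<and> wt d a \<sqsubseteq> i} \<union> {d})"
    using less.IH by (intro lt_nu_UN lt_nu_idx lt_nu_Un) (auto intro: lt_nu_finite)
  ultimately show ?case
    by (rule lt_nu_subset)
qed

text \<open>For \<open>a \<prec> b\<close> let \<open>i\<close> be the index of the first step from
  \<open>b\<close> to \<open>a\<close>. For \<open>c \<prec> a\<close> the first step
  \<open>d\<close> from \<open>b\<close> to \<open>c\<close> is one of the fewer than \<nu> points
  of index at most \<open>i\<close>. Unless \<open>c = d\<close> or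
  \<open>wt d c \<sqsubseteq> i\<close>, this gives \<open>wt b c = wt d c\<close>, which equals
  \<open>wt a c\<close> up to a small set by induction.\<close>

lemma wt_coherent: "lt_nu {c. c \<prec> a \<and> c \<prec> b \<and> wt a c \<noteq> wt b c}"
proof -
  have main: "lt_nu {c. c \<prec> a \<and> wt a c \<noteq> wt b c}"
    if ab: "a \<prec> b" and IH: "\<And>x y. x \<prec> b \<Longrightarrow> y \<prec> b \<Longrightarrow> lt_nu {c. c \<prec> x \<and> c \<prec> y \<and> wt x c \<noteq> wt y c}"
    for a b
  proof -
    define i where "i = idx b (step b a)"
    let ?D = "{d. d \<prec> b \<and> idx b d \<sqsubseteq> i}"
    let ?S = "\<lambda>d. {c. c \<prec> d \<and> wt d c \<sqsubseteq> i} \<union> {d} \<union> {c. c \<prec> a \<and> c \<prec> d \<and> wt a c \<noteq> wt d c}"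
    have "{c. c \<prec> a \<and> wt a c \<noteq> wt b c} \<subseteq> (\<Union>d\<in>?D. ?S d)"
    proof
      fix c assume "c \<in> {c. c \<prec> a \<and> wt a c \<noteq> wt b c}"
      then have c: "c \<prec> a" "wt a c \<noteq> wt b c"
        by auto
      have cb: "c \<prec> b"
        using c(1) ab by (rule k.less_trans)
      let ?d = "step b c"
      \<comment> \<open>The step towards \<open>a\<close> lies above \<open>c\<close>, so it is also
        a candidate for the step towards \<open>c\<close> and bounds the index of the
        latter.\<close>
      have "c \<preceq> step b a"
        using c(1) step(1)[OF ab] by (meson k.less_imp_le k.order_trans)
      then have gi: "idx b ?d \<sqsubseteq> i"
        unfolding i_def using step(3)[OF cb] step(2)[OF ab] by blast
      have "c \<in> ?S ?d"
      proof (cases "c = ?d \<or> wt ?d c \<sqsubseteq> i")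
        case True
        then show ?thesis
          using step(1)[OF cb] by (auto simp: k.le_less)
      next
        case False
        then have "c \<prec> ?d"
          using step(1)[OF cb] by (auto simp: k.le_less)
        moreover have "idx b ?d \<sqsubseteq> wt ?d c"
          using False gi by (meson n.linear n.order_trans)
        ultimately show ?thesis
          using c wt[OF cb] by auto
      qed
      then show "c \<in> (\<Union>d\<in>?D. ?S d)"
        using step(2)[OF cb] gi by blast
    qed
    moreover have "lt_nu (\<Union>d\<in>?D. ?S d)"
      using IH[OF ab] by (intro lt_nu_UN lt_nu_idx lt_nu_Un wt_fibres) (auto intro: lt_nu_finite)
    ultimately show ?thesis
      by (rule lt_nu_subset)
  qed
  have "lt_nu {c. c \<prec> x \<and> c \<prec> y \<and> wt x c \<noteq> wt y c}" if "x \<prec> b" "y \<prec> b" for x y b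
    using that
  proof (induction b arbitrary: x y rule: k.less_induct)
    case (less b)
    have *: "lt_nu {c. c \<prec> x \<and> c \<prec> y \<and> wt x c \<noteq> wt y c}" if "x \<prec> y" "y \<prec> b" for x y
      by (rule lt_nu_subset[OF _ main[OF that(1) less.IH[OF that(2)]]]) auto
    consider "x \<prec> y" | "x = y" | "y \<prec> x"
      using k.less_linear by blast
    then show ?case
    proof cases
      case 3
      show ?thesis
        by (rule lt_nu_subset[OF _ *[OF 3 less.prems(1)]]) auto
    qed (simp_all add: * less.prems lt_nu_finite)
  qed
  then show ?thesis
    using k_bounded[of "{a, b}"] lt_nu_le_nu[OF lt_nu_finite, of "{a, b}"] by auto
qed

text \<open>These functions form the levels of the coherent Aronszajn tree. The value at
  \<open>b\<close> itself is free, being a single exception at most; \<open>wt b b\<close> is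
  unconstrained anyway.\<close>

definition waits :: "'k \<Rightarrow> ('k \<Rightarrow> 'n) \<Rightarrow> bool" where
  "waits b u \<longleftrightarrow> lt_nu {c. c \<preceq> b \<and> u c \<noteq> wt b c}"

lemma waits_wt: 
  assumes "a \<preceq> b"
  shows "waits a (wt b)"
proof -
  have "{c. c \<preceq> a \<and> wt b c \<noteq> wt a c} \<subseteq> {c. c \<prec> a \<and> c \<prec> b \<and> wt a c \<noteq> wt b c} \<union> {a}"
    using assms by (auto simp: k.le_less intro: k.less_trans)
  moreover have "lt_nu \<dots>"
    by (intro lt_nu_Un wt_coherent lt_nu_finite) simp
  ultimately show ?thesis
    unfolding waits_def by (rule lt_nu_subset)
qed

lemma waits_fibres:
  assumes "waits b u"
  shows "lt_nu {c. c \<preceq> b \<and> u c = i}"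
proof -
  have "{c. c \<preceq> b \<and> u c = i} \<subseteq> {c. c \<preceq> b \<and> u c \<noteq> wt b c} \<union> {c. c \<prec> b \<and> wt b c \<sqsubseteq> i} \<union> {b}"
    by (auto simp: k.le_less)
  moreover have "lt_nu \<dots>"
    using lt_nu_Un[OF lt_nu_Un[OF assms[unfolded waits_def] wt_fibres] lt_nu_finite[of "{b}"]] by simp
  ultimately show ?thesis
    by (rule lt_nu_subset)
qed

text \<open>Through \<open>idx b\<close>, the places where \<open>u\<close> departs from
  \<open>wt b\<close> become a bounded subset of \<nu>, so \<open>u\<close> is described by a
  function on a proper initial segment of \<nu>; by \<open>nu_less\<close> there are \<nu> of
  these.\<close>

lemma waits_count:
  "\<exists>V. le_nu V \<and> (\<forall>u. waits b u \<longrightarrow> (\<exists>v\<in>V. \<forall>c. c \<preceq> b \<longrightarrow> v c = u c))"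
proof -
  define P where "P = {(x, f :: 'n \<Rightarrow> 'n). \<forall>y. y \<notin> underS rn x \<longrightarrow> f y = undefined}"
  define v where "v = (\<lambda>(x, f :: 'n \<Rightarrow> 'n) c. if idx b c \<sqsubset> x then f (idx b c) else wt b c)"
  have "le_nu P"
    unfolding P_def le_nu_iff using nu_less by (rule ordIso_imp_ordLeq)
  then have "le_nu (v ` P)"
    by (rule le_nu_image)
  moreover have "\<exists>w\<in>v ` P. \<forall>c. c \<preceq> b \<longrightarrow> w c = u c" if "waits b u" for u
  proof -
    have "lt_nu (idx b ` {c. c \<preceq> b \<and> u c \<noteq> wt b c})"
      using that unfolding waits_def by (rule lt_nu_image)
    then obtain x where x: "\<And>c. c \<preceq> b \<Longrightarrow> u c \<noteq> wt b c \<Longrightarrow> idx b c \<sqsubset> x"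
      using n_bounded by force
    define f where "f y = (if y \<sqsubset> x then u (inv_into {c. c \<preceq> b} (idx b) y) else undefined)" for y
    have "(x, f) \<in> P"
      by (simp add: P_def f_def underS_rn)
    moreover have "v (x, f) c = u c" if "c \<preceq> b" for c
      using that x[OF that] by (cases "u c = wt b c") (auto simp: v_def f_def inv_into_f_f[OF inj_on_idx])
    ultimately show ?thesis
      by blast
  qed
  ultimately show ?thesis
    by blast
qed

subsection \<open>Trees attached to points\<close>

definition npair :: "'n \<times> 'n \<Rightarrow> 'n" where
  "npair = (SOME f. inj f)"

lemma inj_npair: "inj npair"
proof -
  have "le_nu (UNIV \<times> UNIV :: ('n \<times> 'n) set)"
    by (intro le_nu_Times le_nu_UNIV)
  then have "\<exists>f :: 'n \<times> 'n \<Rightarrow> 'n. inj f"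
    unfolding le_nu_iff card_of_ordLeq[symmetric] by auto
  then show ?thesis
    unfolding npair_def by (rule someI_ex)
qed

definition kpack :: "'k \<times> 'n set \<Rightarrow> 'k" where
  "kpack = (SOME f. inj f)"

text \<open>Here \<open>\<kappa> = 2\<^sup>\<nu>\<close> enters: there are only \<kappa> pairs of a
  point of \<kappa> and a subset of \<nu>.\<close>

lemma inj_kpack: "inj kpack"
proof -
  have inf: "infinite (UNIV :: 'k set)"
    using not_le_nu_UNIV lt_nu_finite lt_nu_le_nu by blast
  have "|UNIV :: 'n set set| \<le>o |UNIV :: 'k set|"
    using kappa_pow ordIso_symmetric ordIso_imp_ordLeq by blast
  then have "|UNIV \<times> UNIV :: ('k \<times> 'n set) set| \<le>o |UNIV :: 'k set|"
    using inf by (intro card_of_Times_ordLeq_infinite_Field) 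
      (simp_all add: Field_card_of card_of_card_order_on card_of_mono1)
  then have "\<exists>f :: 'k \<times> 'n set \<Rightarrow> 'k. inj f"
    unfolding card_of_ordLeq[symmetric] by auto
  then show ?thesis
    unfolding kpack_def by (rule someI_ex)
qed

text \<open>The restriction of \<open>h\<close> up to \<open>b\<close> as a single point of
  \<kappa>: its graph, moved into \<nu> by \<open>idx b\<close>, with the level stored alongside.
  Places with value \<open>None\<close> leave no trace in the graph. Thus the trees live on
  \<kappa>, like those in the hypothesis.\<close>

definition node :: "'k \<Rightarrow> ('k \<Rightarrow> 'n option) \<Rightarrow> 'k" where
  "node b h = kpack (b, \<Union>c\<in>{c. c \<preceq> b}. (\<lambda>i. npair (idx b c, i)) ` set_option (h c))"

lemma node_eq_iff: "node a h = node b h' \<longleftrightarrow> a = b \<and> (\<forall>c. c \<preceq> a \<longrightarrow> h c = h' c)"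
proof -
  define graph where "graph b h = (\<Union>c\<in>{c. c \<preceq> b}. (\<lambda>i. npair (idx b c, i)) ` set_option (h c))"
    for b and h :: "'k \<Rightarrow> 'n option"
  have mem: "npair (idx b c, i) \<in> graph b h \<longleftrightarrow> h c = Some i" if "c \<preceq> b" for c i b h
  proof
    assume "npair (idx b c, i) \<in> graph b h"
    then obtain c' where c': "idx b c = idx b c'" "c' \<preceq> b" "h c' = Some i"
      unfolding graph_def by (auto simp: inj_eq[OF inj_npair])
    then have "c = c'"
      using that inj_onD[OF inj_on_idx[of b] c'(1)] by simp
    then show "h c = Some i"
      using c'(3) by simp
  qed (use that in \<open>auto simp: graph_def\<close>)
  have node: "node b h = kpack (b, graph b h)" for b h
    by (simp add: node_def graph_def)
  have "graph b h = graph b h' \<longleftrightarrow> (\<forall>c. c \<preceq> b \<longrightarrow> h c = h' c)" for b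
  proof
    assume eq: "graph b h = graph b h'"
    have "h c = h' c" if "c \<preceq> b" for c
      using mem[OF that, of _ h] mem[OF that, of _ h'] unfolding eq
      by (cases "h c"; cases "h' c") auto
    then show "\<forall>c. c \<preceq> b \<longrightarrow> h c = h' c"
      by simp
  next
    assume "\<forall>c. c \<preceq> b \<longrightarrow> h c = h' c"
    then show "graph b h = graph b h'"
      by (simp add: graph_def)
  qed
  then show ?thesis
    unfolding node inj_eq[OF inj_kpack] by auto
qed

definition k0 :: 'k where
  "k0 = (SOME a. \<forall>b. a \<preceq> b)"

lemma k0_le: "k0 \<preceq> b"
proof -
  have "\<exists>a. \<forall>b. a \<preceq> b"
    using k.exists_least_iff[of "\<lambda>_. True"] k.not_less by blast
  from someI_ex[OF this] show ?thesis
    unfolding k0_def by blast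
qed

text \<open>A sequence \<open>h\<close> jumps at \<open>c\<close> if \<open>h c = None\<close>. It has to jump at \<open>k0\<close>, so that there always is a
  last jump; its existence makes the set of jumps closed.\<close>

definition okp :: "('k \<Rightarrow> 'k) \<Rightarrow> 'k \<Rightarrow> ('k \<Rightarrow> 'n option) \<Rightarrow> bool" where
  "okp x c h \<longleftrightarrow> (h c = None \<and> (c = k0 \<or> x c = node c h)) \<or>
     (\<exists>u d. waits c u \<and> d \<prec> c \<and> h d = None \<and> (\<forall>a. d \<prec> a \<and> a \<preceq> c \<longrightarrow> h a = Some (u a)))"

lemma okp_cong:
  assumes "x c = x' c" "\<And>a. a \<preceq> c \<Longrightarrow> h a = h' a"
  shows "okp x c h \<longleftrightarrow> okp x' c h'"
proof -
  have "node c h = node c h'"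
    using assms(2) by (simp add: node_eq_iff)
  moreover have "h d = h' d" if "d \<prec> c" for d
    using assms(2) that k.less_imp_le by blast
  ultimately show ?thesis
    using assms unfolding okp_def by (metis k.order_refl)
qed

section \<open>The tree of \<open>x\<close>, its order and its branches\<close>

definition ok :: "('k \<Rightarrow> 'k) \<Rightarrow> 'k \<Rightarrow> ('k \<Rightarrow> 'n option) \<Rightarrow> bool" where
  "ok x b h \<longleftrightarrow> (\<forall>c. c \<preceq> b \<longrightarrow> okp x c h)"

lemma ok_cong:
  assumes "\<And>a. a \<preceq> b \<Longrightarrow> x a = x' a" "\<And>a. a \<preceq> b \<Longrightarrow> h a = h' a"
  shows "ok x b h \<longleftrightarrow> ok x' b h'"
proof -
  have "okp x c h \<longleftrightarrow> okp x' c h'" if "c \<preceq> b" for c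
    using that by (intro okp_cong assms) (auto intro: k.order_trans)
  then show ?thesis
    unfolding ok_def by simp
qed

lemma ok_mono: "ok x b h \<Longrightarrow> a \<preceq> b \<Longrightarrow> ok x a h"
  unfolding ok_def using k.order_trans by blast

lemma ok_less: "ok x b h \<Longrightarrow> a \<prec> b \<Longrightarrow> ok x a h"
  using ok_mono k.less_imp_le by blast

definition tree :: "('k \<Rightarrow> 'k) \<Rightarrow> 'k set" where
  "tree x = {node b h | b h. ok x b h}"

text \<open>The order lives on the codes of all sequences, independently of \<open>x\<close>; this
  helps to express specialness by a closed condition.\<close>

definition tlt :: "('k \<times> 'k) set" where
  "tlt = {(node a h, node b h) | a b h. a \<prec> b}"

definition branching :: "('k \<Rightarrow> 'k) set" where
  "branching = {x. \<exists>h. \<forall>c. okp x c h}"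

lemma node_in_tree: "node b h \<in> tree x \<longleftrightarrow> ok x b h"
proof
  assume "node b h \<in> tree x"
  then obtain h' where "\<And>c. c \<preceq> b \<Longrightarrow> h c = h' c" "ok x b h'"
    unfolding tree_def by (auto simp: node_eq_iff)
  then show "ok x b h"
    using ok_cong[of b x x h h'] by simp
qed (auto simp: tree_def)

lemma tlt_iff: "(node a h, node b h') \<in> tlt \<longleftrightarrow> a \<prec> b \<and> (\<forall>c. c \<preceq> a \<longrightarrow> h c = h' c)"
proof
  assume "a \<prec> b \<and> (\<forall>c. c \<preceq> a \<longrightarrow> h c = h' c)"
  then have "node a h = node a h'" "a \<prec> b"
    by (auto simp: node_eq_iff)
  then show "(node a h, node b h') \<in> tlt"
    unfolding tlt_def by auto
next
  assume "(node a h, node b h') \<in> tlt"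
  then obtain k where "a \<prec> b" "node a h = node a k" "node b h' = node b k"
    unfolding tlt_def by (auto simp: node_eq_iff)
  then show "a \<prec> b \<and> (\<forall>c. c \<preceq> a \<longrightarrow> h c = h' c)"
    by (auto simp: node_eq_iff intro: k.order_trans k.less_imp_le)
qed

lemma tlt_node: "(s, node b h) \<in> tlt \<longleftrightarrow> (\<exists>a. a \<prec> b \<and> s = node a h)"
proof
  assume s: "(s, node b h) \<in> tlt"
  then obtain a h' where "s = node a h'"
    unfolding tlt_def by auto
  with s show "\<exists>a. a \<prec> b \<and> s = node a h"
    by (auto simp: tlt_iff node_eq_iff)
qed (auto simp: tlt_iff)

lemma tree_cases:
  assumes "t \<in> tree x"
  obtains b h where "t = node b h" "ok x b h"
  using assms unfolding tree_def by auto

lemma trans_tlt: "trans tlt"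
proof (rule transI)
  fix s t u assume "(s, t) \<in> tlt" "(t, u) \<in> tlt"
  moreover obtain b h where "u = node b h"
    using \<open>(t, u) \<in> tlt\<close> unfolding tlt_def by auto
  ultimately show "(s, u) \<in> tlt"
    by (auto simp: tlt_node) (blast intro: k.less_trans)
qed

lemma irrefl_tlt: "(t, t) \<notin> tlt"
  unfolding tlt_def by (auto simp: node_eq_iff)

lemma tlt_in_tree: "(s, t) \<in> tlt \<Longrightarrow> t \<in> tree x \<Longrightarrow> s \<in> tree x"
  by (erule tree_cases) (auto simp: tlt_node node_in_tree intro: ok_less)

abbreviation tord :: "('k \<Rightarrow> 'k) \<Rightarrow> ('k \<times> 'k) set" where
  "tord x \<equiv> Restr tlt (tree x)"

lemma htrel_tree:
  assumes "ok x b h"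
  shows "htrel (tord x) (node b h) = dir_image (Restr r (underS r b)) (\<lambda>a. node a h)"
proof -
  have p: "tpred (tord x) (node b h) = (\<lambda>a. node a h) ` {a. a \<prec> b}"
    using assms by (auto simp: tpred_def tlt_node node_in_tree intro: ok_less)
  have "(node a h, node c h) \<in> (tord x)\<^sup>= \<longleftrightarrow> a \<preceq> c" if "a \<prec> b" "c \<prec> b" for a c
    using assms that
    by (auto simp: tlt_iff node_in_tree node_eq_iff k.le_less intro: ok_less)
  then show ?thesis
    unfolding htrel_def p dir_image_def underS_r by (auto simp: kle_def)
qed

lemma inj_on_node: "inj_on (\<lambda>a. node a h) S"
  by (auto simp: inj_on_def node_eq_iff)

lemma htrel_tree_iso:
  assumes "ok x b h"
  shows "Restr r (underS r b) =o htrel (tord x) (node b h)"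
  unfolding htrel_tree[OF assms]
  by (rule dir_image_ordIso[OF Well_order_Restr[OF Well_r] inj_on_node])

lemma Restr_underS_less:
  assumes "a \<prec> b"
  shows "Restr r (underS r a) <o Restr r (underS r b)"
proof -
  let ?R = "Restr r (underS r b)"
  have F: "Field ?R = underS r b"
    by (auto simp: Field_def underS_r kle_def[symmetric] Domain_iff Range_iff)
  have "underS ?R a = underS r a"
    using assms by (auto simp: underS_def kless_def[symmetric] kle_def[symmetric] k.le_less
        intro: k.less_trans)
  moreover have "Restr ?R (underS r a) = Restr r (underS r a)"
    using assms by (auto simp: underS_r intro: k.less_trans)
  moreover have "Restr ?R (underS ?R a) <o ?R"
  proof (rule underS_Restr_ordLess[OF Well_order_Restr[OF Well_r]])
    show "Field ?R \<noteq> {}"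
      unfolding F using assms by (auto simp: underS_r)
  qed
  ultimately show ?thesis
    by simp
qed

lemma Restr_underS_inj:
  assumes "Restr r (underS r a) =o Restr r (underS r b)"
  shows "a = b"
  using assms Restr_underS_less not_ordLess_ordIso ordIso_symmetric k.less_linear by metis

section \<open>Levels and their size\<close>

definition level :: "('k \<Rightarrow> 'k) \<Rightarrow> 'k \<Rightarrow> 'k set" where
  "level x b = {node b h | h. ok x b h}"

lemma tlevel_tree: "tlevel r (tree x) (tord x) b = level x b"
proof -
  have "htrel (tord x) (node a h) =o Restr r (underS r b) \<longleftrightarrow> a = b" if "ok x a h" for a h
    using htrel_tree_iso[OF that] Restr_underS_inj[of a b]
    by (meson ordIso_symmetric ordIso_transitive)
  then show ?thesis
    unfolding tlevel_def level_def tree_def by auto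
qed

lemma jump_cases:
  assumes "okp x c h" "h c = None"
  shows "c = k0 \<or> x c = node c h"
  using assms unfolding okp_def by (auto dest: spec[of _ c])

text \<open>If \<open>h\<close> jumps at \<open>b\<close>, then \<open>b\<close> is the last jump
  and nothing remains to be followed; the weight of \<open>b\<close> serves as
  \<open>u\<close>.\<close>

lemma last_jump:
  assumes "okp x b h"
  shows "\<exists>u d. waits b u \<and> d \<preceq> b \<and> h d = None \<and> (\<forall>a. d \<prec> a \<and> a \<preceq> b \<longrightarrow> h a = Some (u a))"
  using assms unfolding okp_def
  by (metis k.less_imp_le k.not_less k.order_refl waits_wt)

text \<open>A node is determined by its last jump \<open>d\<close> and the waiting function after
  it: up to \<open>d\<close> the sequence is read off from \<open>x d\<close>, or consists of one
  jump if \<open>d = k0\<close>. Now \<open>waits_count\<close> applies.\<close>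

lemma le_nu_level: "le_nu (level x b)"
proof -
  obtain V where V: "le_nu V" "\<And>u. waits b u \<Longrightarrow> \<exists>v\<in>V. \<forall>c. c \<preceq> b \<longrightarrow> v c = u c"
    using waits_count by metis
  \<comment> \<open>For \<open>d\<close> other than \<open>k0\<close> this decodes
    \<open>x d\<close>. If \<open>x d\<close> codes no sequence of length \<open>d\<close>, the
    choice is arbitrary, but then no admissible sequence jumps at \<open>d\<close>.\<close>
  define past where "past d = (if d = k0 then (\<lambda>_. None) else (SOME h. x d = node d h))" for d
  define F where "F = (\<lambda>(d, v). node b (\<lambda>a. if a \<preceq> d then past d a else Some (v a)))"
  have "level x b \<subseteq> F ` ({d. d \<preceq> b} \<times> V)"
  proof
    fix t assume "t \<in> level x b"
    then obtain h where t: "t = node b h" and h: "ok x b h"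
      unfolding level_def by auto
    then obtain u d where u: "waits b u" "d \<preceq> b" "h d = None"
        "\<And>a. d \<prec> a \<Longrightarrow> a \<preceq> b \<Longrightarrow> h a = Some (u a)"
      using last_jump[of x b h] unfolding ok_def by blast
    obtain v where v: "v \<in> V" "\<And>c. c \<preceq> b \<Longrightarrow> v c = u c"
      using V(2)[OF u(1)] by blast
    have "d = k0 \<or> x d = node d h"
      using h u(2,3) by (intro jump_cases) (auto simp: ok_def)
    then have "past d a = h a" if "a \<preceq> d" for a
    proof
      assume "d = k0"
      with that have "a = d"
        by (metis k.order_antisym k0_le)
      with \<open>d = k0\<close> u(3) show ?thesis
        by (simp add: past_def)
    next
      assume *: "x d = node d h"
      then have "x d = node d (SOME h. x d = node d h)"
        by (rule someI[of "\<lambda>h. x d = node d h"])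
      then have "d = k0 \<or> node d h = node d (past d)"
        by (simp add: past_def *)
      then show ?thesis
        using that u(3) by (auto simp: node_eq_iff past_def dest: k.order_antisym[OF _ k0_le])
    qed
    then have "t = F (d, v)"
      unfolding t F_def using u v by (auto simp: node_eq_iff k.not_le)
    then show "t \<in> F ` ({d. d \<preceq> b} \<times> V)"
      using u(2) v(1) by auto
  qed
  moreover have "le_nu (F ` ({d. d \<preceq> b} \<times> V))"
    by (intro le_nu_image le_nu_Times le_nu_atMost V)
  ultimately show ?thesis
    by (rule le_nu_subset)
qed

lemma level_nonempty: "level x b \<noteq> {}"
proof -
  define h where "h a = (if a = k0 then None else Some (wt b a))" for a
  have "okp x c h" if "c \<preceq> b" for c
  proof (cases "c = k0")
    case False
    then have "k0 \<prec> c"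
      using k0_le k.le_less by blast
    moreover have "h a = Some (wt b a)" if "k0 \<prec> a" for a
      using that by (auto simp: h_def)
    ultimately show ?thesis
      unfolding okp_def using waits_wt[OF \<open>c \<preceq> b\<close>] by (metis h_def)
  qed (simp add: okp_def h_def)
  then show ?thesis
    unfolding level_def ok_def by blast
qed

text \<open>Comparable nodes agree where both are defined, so an unbounded chain glues together to
  one sequence.\<close>

lemma unbounded_chain_branching:
  assumes B: "B \<subseteq> tree x" and chain: "\<And>s t. s \<in> B \<Longrightarrow> t \<in> B \<Longrightarrow> s = t \<or> (s, t) \<in> tlt \<or> (t, s) \<in> tlt"
    and unb: "\<And>c. \<exists>b h. c \<preceq> b \<and> node b h \<in> B"
  shows "x \<in> branching"
proof -
  obtain \<beta> \<eta> where \<beta>: "\<And>c. c \<preceq> \<beta> c" "\<And>c. node (\<beta> c) (\<eta> c) \<in> B"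
    using unb by metis
  have coh: "h a = h' a" if "node b h \<in> B" "node b' h' \<in> B" "a \<preceq> b" "a \<preceq> b'" for a b b' h h'
    using chain[OF that(1,2)] that(3,4) by (auto simp: node_eq_iff tlt_iff)
  define H where "H a = \<eta> a a" for a
  have H: "H a = \<eta> c a" if "a \<preceq> c" for a c
    unfolding H_def using \<beta> that by (intro coh[of "\<beta> a" "\<eta> a" "\<beta> c"]) (auto intro: k.order_trans)
  have "okp x c H" for c
  proof -
    have "okp x c (\<eta> c)"
      using \<beta> B node_in_tree unfolding ok_def by blast
    then show ?thesis
      using okp_cong[of x c x H "\<eta> c"] H by simp
  qed
  then show ?thesis
    unfolding branching_def by blast
qed

lemma tree_unbounded:
  assumes "S \<subseteq> tree x" "\<not> le_nu S"
  shows "\<exists>b h. c \<preceq> b \<and> node b h \<in> S"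
proof (rule ccontr)
  assume *: "\<not> ?thesis"
  have "S \<subseteq> (\<Union>a\<in>{a. a \<preceq> c}. level x a)"
  proof
    fix t assume "t \<in> S"
    then obtain b h where "t = node b h" "ok x b h"
      using assms(1) tree_cases by blast
    then show "t \<in> (\<Union>a\<in>{a. a \<preceq> c}. level x a)"
      using * \<open>t \<in> S\<close> k.linear unfolding level_def by blast
  qed
  moreover have "le_nu (\<Union>a\<in>{a. a \<preceq> c}. level x a)"
    by (intro le_nu_UN le_nu_atMost le_nu_level)
  ultimately show False
    using assms(2) le_nu_subset by blast
qed

lemma aronszajn_tree:
  assumes "x \<notin> branching"
  shows "kappa_aronszajn r (tree x) (tord x)"
proof -
  have "is_tree (tree x) (tord x)"
    unfolding is_tree_def
  proof (intro conjI ballI allI)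
    show "trans (tord x)"
      using trans_tlt by (auto simp: trans_def)
    show "Well_order (htrel (tord x) t)" if "t \<in> tree x" for t
      using that htrel_tree_iso unfolding ordIso_def by (auto elim: tree_cases)
  qed (auto simp: irrefl_tlt)
  moreover have "htrel (tord x) t <o r" if "t \<in> tree x" for t
    using that
  proof (rule tree_cases)
    fix b h assume t: "t = node b h" "ok x b h"
    have "Restr r (underS r b) <o r"
      by (rule underS_Restr_ordLess[OF Well_r]) simp_all
    then show ?thesis
      unfolding t(1) using htrel_tree_iso[OF t(2)] ordIso_symmetric ordIso_ordLess_trans by blast
  qed
  moreover have "\<not> (\<exists>B \<subseteq> tree x. is_chain (tord x) B \<and> Restr ((tord x)\<^sup>=) B =o r)"
  proof
    assume "\<exists>B \<subseteq> tree x. is_chain (tord x) B \<and> Restr ((tord x)\<^sup>=) B =o r"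
    then obtain B where B: "B \<subseteq> tree x" "is_chain (tord x) B" "Restr ((tord x)\<^sup>=) B =o r"
      by blast
    have "|Field (Restr ((tord x)\<^sup>=) B)| =o |Field r|"
      using B(3) by (rule card_of_cong)
    moreover have "Field (Restr ((tord x)\<^sup>=) B) = B"
      by (auto simp: Field_def)
    ultimately have "|B| =o |UNIV :: 'k set|"
      by simp
    then have "\<not> le_nu B"
      using not_le_nu_UNIV ordIso_symmetric ordIso_ordLeq_trans by blast
    then have "x \<in> branching"
      using B by (intro unbounded_chain_branching[OF B(1)] tree_unbounded) (auto simp: is_chain_def)
    then show False
      using assms by simp
  qed
  ultimately show ?thesis
    unfolding kappa_aronszajn_def height_kappa_tree_def
    by (simp add: tlevel_tree level_nonempty le_nu_level less_nu_iff)
qed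

section \<open>Colourings and closure points\<close>

lemma le_nu_finite: "finite A \<Longrightarrow> le_nu A"
  by (rule lt_nu_le_nu[OF lt_nu_finite])

lemma k_least:
  fixes b :: 'k
  assumes "P b"
  obtains c where "P c" "\<And>d. d \<prec> c \<Longrightarrow> \<not> P d"
  using iffD1[OF k.exists_least_iff, of P] assms by blast

text \<open>By recursion along \<open>R\<close>, each point takes a colour that its fewer than \<nu>
  predecessors do not use. This will split part of a tree into \<nu> antichains.\<close>

lemma ex_colouring:
  assumes "wf R" and small: "\<And>t. lt_nu {s. (s, t) \<in> R}"
  shows "\<exists>col :: 'b \<Rightarrow> 'n. \<forall>s t. (s, t) \<in> R \<longrightarrow> col s \<noteq> col t"
proof -
  have "\<exists>col :: 'b \<Rightarrow> 'n. \<forall>t. col t \<notin> col ` {s. (s, t) \<in> R}"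
  proof (rule dependent_wf_choice[OF \<open>wf R\<close>, where P = "\<lambda>col t i. i \<notin> col ` {s. (s, t) \<in> R}"])
    show "(i \<notin> f ` {s. (s, t) \<in> R}) = (i \<notin> g ` {s. (s, t) \<in> R})"
      if "\<And>z. (z, t) \<in> R \<Longrightarrow> f z = g z" for f g :: "'b \<Rightarrow> 'n" and t i
      using that by auto
    show "\<exists>i. i \<notin> f ` {s. (s, t) \<in> R}" for f :: "'b \<Rightarrow> 'n" and t
    proof -
      have "lt_nu (f ` {s. (s, t) \<in> R})"
        using small by (rule lt_nu_image)
      then have "f ` {s. (s, t) \<in> R} \<noteq> UNIV"
        using ordLess_irreflexive unfolding lt_nu_iff by metis
      then show ?thesis
        by blast
    qed
  qed
  then obtain col :: "'b \<Rightarrow> 'n" where col: "\<And>t. col t \<notin> col ` {s. (s, t) \<in> R}"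
    by blast
  have "col s \<noteq> col t" if "(s, t) \<in> R" for s t
  proof -
    have mem: "col s \<in> col ` {s. (s, t) \<in> R}"
      using that by (intro imageI CollectI)
    show ?thesis
    proof
      assume eq: "col s = col t"
      show False
        using mem col[of t] unfolding eq by contradiction
    qed
  qed
  then show ?thesis
    by blast
qed

text \<open>Iterate \<omega> times a function that dominates \<open>F\<close> on initial segments;
  the supremum of the iterates is closed under \<open>F\<close>. It exists since \<nu> is infinite
  and \<kappa> is regular.\<close>

lemma ex_closed:
  fixes F :: "'k \<Rightarrow> 'k"
  shows "\<exists>c. a \<prec> c \<and> (\<forall>d. d \<prec> c \<longrightarrow> F d \<prec> c)"
proof -
  have "\<exists>b. d \<prec> b \<and> (\<forall>e. e \<preceq> d \<longrightarrow> F e \<prec> b)" for d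
  proof -
    have "le_nu (F ` {e. e \<preceq> d} \<union> {d})"
      by (intro le_nu_Un le_nu_image le_nu_atMost le_nu_finite) simp
    from k_bounded[OF this] obtain b where "\<forall>e\<in>F ` {e. e \<preceq> d} \<union> {d}. e \<prec> b" ..
    then show ?thesis
      by (intro exI[of _ b]) auto
  qed
  then obtain G where G: "\<And>d. d \<prec> G d" "\<And>d e. e \<preceq> d \<Longrightarrow> F e \<prec> G d"
    by metis
  have "le_nu (UNIV :: nat set)"
    using nu_inf by (simp add: le_nu_iff infinite_iff_card_of_nat)
  then have "le_nu (range (\<lambda>n. (G ^^ n) a))"
    by (rule le_nu_image)
  from k_bounded[OF this] obtain b where "\<forall>n. (G ^^ n) a \<prec> b"
    by auto
  then obtain c where c: "\<forall>n. (G ^^ n) a \<prec> c" "\<And>d. d \<prec> c \<Longrightarrow> \<not> (\<forall>n. (G ^^ n) a \<prec> d)"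
    by (rule k_least) blast
  have "F d \<prec> c" if d: "d \<prec> c" for d
  proof -
    obtain n where "d \<preceq> (G ^^ n) a"
      using c(2)[OF d] k.not_less by blast
    then have "F d \<prec> (G ^^ Suc n) a"
      using G(2) by simp
    then show ?thesis
      using c(1)[rule_format] by (rule k.less_trans)
  qed
  moreover have "a \<prec> c"
    using c(1)[rule_format, of 0] by simp
  ultimately show ?thesis
    by blast
qed

subsection \<open>No Souslin subtrees\<close>

definition lev :: "'k \<Rightarrow> 'k" where
  "lev t = (SOME b. \<exists>h. t = node b h)"

lemma lev_node [simp]: "lev (node b h) = b"
  unfolding lev_def by (rule some_equality) (auto simp: node_eq_iff)

text \<open>Besides giving the top value of a node, it later reads an element of
  \<open>'n option\<close> off any point of \<kappa>; on points that are no codes any value will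
  do.\<close>

definition lastval :: "'k \<Rightarrow> 'n option" where
  "lastval t = (SOME v. \<exists>b h. t = node b h \<and> v = h b)"

lemma lastval_node [simp]: "lastval (node b h) = h b"
  unfolding lastval_def by (rule some_equality) (auto simp: node_eq_iff)

lemma wf_tlt: "wf tlt"
proof (rule wf_subset)
  show "wf (inv_image {(a, b). a \<prec> b} lev)"
    by (rule wf_inv_image[OF wf_kless])
  show "tlt \<subseteq> inv_image {(a, b). a \<prec> b} lev"
    by (auto simp: tlt_def)
qed

lemma tlt_node_reflcl: "(s, node b h) \<in> tlt\<^sup>= \<longleftrightarrow> (\<exists>a. a \<preceq> b \<and> s = node a h)"
  by (auto simp: tlt_node k.le_less)

lemma tlt_comparable:
  assumes "(s, u) \<in> tlt\<^sup>=" "(t, u) \<in> tlt\<^sup>=" "u \<in> tree x"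
  shows "s = t \<or> (s, t) \<in> tlt \<or> (t, s) \<in> tlt"
  using assms(3)
proof (rule tree_cases)
  fix b h assume "u = node b h"
  then obtain a c where "s = node a h" "t = node c h"
    using assms(1,2) tlt_node_reflcl by blast
  then show ?thesis
    using k.less_linear[of a c] by (auto simp: tlt_iff)
qed

definition cone :: "'k set \<Rightarrow> 'k \<Rightarrow> 'k set" where
  "cone R t = {s \<in> R. (t, s) \<in> tlt\<^sup>=}"

text \<open>Passing to nodes with a large cone replaces a Souslin tree \<open>R\<close> by a pruned
  one: closed under restriction, with extensions at every higher level.\<close>

abbreviation big :: "'k set \<Rightarrow> 'k \<Rightarrow> bool" where
  "big R t \<equiv> \<not> le_nu (cone R t)"

context
  fixes x :: "'k \<Rightarrow> 'k" and R :: "'k set"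
  assumes R: "R \<subseteq> tree x" and R_big: "\<not> le_nu R"
    and R_antichain: "\<And>X. X \<subseteq> R \<Longrightarrow> (\<And>s t. s \<in> X \<Longrightarrow> t \<in> X \<Longrightarrow> (s, t) \<notin> tlt) \<Longrightarrow> le_nu X"
begin

lemma big_in_tree: "big R t \<Longrightarrow> t \<in> tree x"
proof -
  assume "big R t"
  then have "cone R t \<noteq> {}"
    using le_nu_finite[of "{}"] by auto
  then show ?thesis
    using R tlt_in_tree unfolding cone_def by blast
qed

text \<open>Else \<open>C\<close> would be covered by the levels up to \<open>b\<close> and by the
  cones of at most \<nu> nodes of level \<open>b\<close>, all of them small.\<close>

lemma big_split:
  assumes C: "C \<subseteq> R" "\<not> le_nu C"
  shows "\<exists>a h. b \<preceq> a \<and> node a h \<in> C \<and> big R (node b h)"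
proof (rule ccontr)
  assume none: "\<not> ?thesis"
  let ?S = "{node b h | a h. b \<preceq> a \<and> node a h \<in> C}"
  have "C \<subseteq> (\<Union>a\<in>{a. a \<preceq> b}. level x a) \<union> (\<Union>s\<in>?S. cone R s)"
  proof
    fix t assume t: "t \<in> C"
    then obtain a h where th: "t = node a h" "ok x a h"
      using C(1) R tree_cases by blast
    show "t \<in> (\<Union>a\<in>{a. a \<preceq> b}. level x a) \<union> (\<Union>s\<in>?S. cone R s)"
    proof (cases "a \<preceq> b")
      case True
      then show ?thesis
        using th by (auto simp: level_def)
    next
      case False
      then have "b \<preceq> a"
        using k.linear by blast
      then have "node b h \<in> ?S" "t \<in> cone R (node b h)"
        using t C(1) by (auto simp: th(1) cone_def tlt_node k.le_less)
      then show ?thesis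
        by blast
    qed
  qed
  moreover have "le_nu ?S"
  proof (rule le_nu_subset[OF _ le_nu_level])
    show "?S \<subseteq> level x b"
    proof
      fix t assume "t \<in> ?S"
      then obtain a h where "t = node b h" "b \<preceq> a" "node a h \<in> tree x"
        using C(1) R by blast
      then show "t \<in> level x b"
        unfolding level_def node_in_tree using ok_mono by blast
    qed
  qed
  then have "le_nu ((\<Union>a\<in>{a. a \<preceq> b}. level x a) \<union> (\<Union>s\<in>?S. cone R s))"
    using none by (intro le_nu_Un le_nu_UN le_nu_atMost le_nu_level) auto
  ultimately show False
    using C(2) le_nu_subset by blast
qed

lemma big_ex: "\<exists>h. big R (node b h)"
  using big_split[OF subset_refl R_big] by blast

lemma big_above:
  assumes "big R (node a h)" "a \<preceq> b"
  shows "\<exists>h'. big R (node b h') \<and> (\<forall>c. c \<preceq> a \<longrightarrow> h' c = h c)"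
proof -
  have "cone R (node a h) \<subseteq> R"
    by (auto simp: cone_def)
  from big_split[OF this assms(1), of b] obtain a' h' where
    "node a' h' \<in> cone R (node a h)" "big R (node b h')"
    by blast
  then show ?thesis
    by (auto simp: cone_def tlt_iff node_eq_iff)
qed

lemma big_mono:
  assumes "big R (node b h)" "a \<preceq> b"
  shows "big R (node a h)"
proof -
  have "cone R (node b h) \<subseteq> cone R (node a h)"
  proof
    fix s assume "s \<in> cone R (node b h)"
    moreover have "(node a h, node b h) \<in> tlt\<^sup>="
      using assms(2) tlt_node_reflcl by blast
    ultimately show "s \<in> cone R (node a h)"
      using trans_tlt unfolding cone_def by (auto dest: transD)
  qed
  then show ?thesis
    using assms(1) le_nu_subset by blast
qed

text \<open>Choose a node of \<open>R\<close> above each member of \<open>X\<close>. Two nodes below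
  a common node are comparable, so the choices are distinct and form an antichain of
  \<open>R\<close>.\<close>

lemma big_antichain:
  assumes X: "\<And>t. t \<in> X \<Longrightarrow> big R t" "\<And>s t. s \<in> X \<Longrightarrow> t \<in> X \<Longrightarrow> (s, t) \<notin> tlt"
  shows "le_nu X"
proof -
  have "\<exists>s. s \<in> cone R t" if "t \<in> X" for t
  proof -
    have "cone R t \<noteq> {}"
      using X(1)[OF that] le_nu_finite[of "{}"] by auto
    then show ?thesis
      by blast
  qed
  then obtain f where f: "\<And>t. t \<in> X \<Longrightarrow> f t \<in> cone R t"
    by metis
  have eq: "s = t" if "s \<in> X" "t \<in> X" "(s, f t) \<in> tlt\<^sup>=" for s t
    using tlt_comparable[of s "f t" t x] f[OF that(2)] X(2) that R by (auto simp: cone_def)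
  have "inj_on f X"
  proof (rule inj_onI)
    fix s t assume "s \<in> X" "t \<in> X" "f s = f t"
    then show "s = t"
      using eq[of s t] f[of s] by (auto simp: cone_def)
  qed
  moreover have "le_nu (f ` X)"
  proof (rule R_antichain)
    show "f ` X \<subseteq> R"
      using f by (auto simp: cone_def)
    fix s t assume "s \<in> f ` X" "t \<in> f ` X"
    then obtain s' t' where st: "s = f s'" "t = f t'" "s' \<in> X" "t' \<in> X"
      by blast
    show "(s, t) \<notin> tlt"
    proof
      assume "(s, t) \<in> tlt"
      then have "(s', f t') \<in> tlt\<^sup>="
        using f[OF st(3)] trans_tlt st by (auto simp: cone_def dest: transD)
      then have "s' = t'"
        using eq st by blast
      then show False
        using \<open>(s, t) \<in> tlt\<close> st irrefl_tlt by simp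
    qed
  qed
  ultimately show ?thesis
    using le_nu_image[of "f ` X" "inv_into X f"] by simp
qed

text \<open>Above a big node without a big jump beyond it, all nodes wait from the same jump on, so that
  \<open>\<nu>\<close> antichains cover them.\<close>

lemma big_jump_above:
  assumes "big R (node b h)"
  shows "\<exists>b' h'. b \<prec> b' \<and> big R (node b' h') \<and> (\<forall>c. c \<preceq> b \<longrightarrow> h' c = h c) \<and> h' b' = None"
proof (rule ccontr)
  assume none: "\<not> ?thesis"
  have wait: "h' b' \<noteq> None" if "b \<prec> b'" "big R (node b' h')" "\<forall>c. c \<preceq> b \<longrightarrow> h' c = h c" for b' h'
  proof
    assume "h' b' = None"
    then have "\<exists>b' h'. b \<prec> b' \<and> big R (node b' h') \<and> (\<forall>c. c \<preceq> b \<longrightarrow> h' c = h c) \<and> h' b' = None"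
      using that by (intro exI[of _ b'] exI[of _ h'] conjI)
    with none show False
      by (rule notE)
  qed
  have "okp x b h"
    using big_in_tree[OF assms] by (simp add: node_in_tree ok_def)
  from last_jump[OF this] obtain u d where
    d: "d \<preceq> b" "h d = None" "\<And>a. d \<prec> a \<Longrightarrow> a \<preceq> b \<Longrightarrow> h a \<noteq> None"
    by blast
  \<comment> \<open>Beyond \<open>b\<close> a big extension never jumps, so its last jump is at most
    \<open>b\<close>, and its values after \<open>b\<close> are those of one waiting function, which
    has small fibres.\<close>
  have fibre: "lt_nu {a. b \<prec> a \<and> a \<preceq> b' \<and> h' a = i}"
    if b': "b \<prec> b'" and big: "big R (node b' h')" and h': "\<forall>c. c \<preceq> b \<longrightarrow> h' c = h c" for b' h' i
  proof -
    have nojump: "h' a \<noteq> None" if "d \<prec> a" "a \<preceq> b'" for a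
    proof (cases "a \<preceq> b")
      case True
      then show ?thesis
        using d(3) h' that by auto
    next
      case False
      then show ?thesis
        using wait[of a h'] h' big_mono[OF big that(2)] k.not_le by blast
    qed
    have "okp x b' h'"
      using big_in_tree[OF big] by (simp add: node_in_tree ok_def)
    from last_jump[OF this] obtain u' d' where
      u': "waits b' u'" and d': "d' \<preceq> b'" "h' d' = None" "\<And>a. d' \<prec> a \<Longrightarrow> a \<preceq> b' \<Longrightarrow> h' a = Some (u' a)"
      by blast
    have "d' \<preceq> b"
      using nojump d' d(1) by (meson k.le_less_trans k.not_le)
    then have val: "h' a = Some (u' a)" if "b \<prec> a" "a \<preceq> b'" for a
      using d'(3) that by (meson k.le_less_trans)
    show ?thesis
    proof (cases i)
      case None
      then have none: "{a. b \<prec> a \<and> a \<preceq> b' \<and> h' a = i} = {}"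
        using val by auto
      show ?thesis
        unfolding none by (rule lt_nu_finite) simp
    next
      case (Some j)
      have "{a. b \<prec> a \<and> a \<preceq> b' \<and> h' a = i} \<subseteq> {a. a \<preceq> b' \<and> u' a = j}"
        using val Some by auto
      then show ?thesis
        using waits_fibres[OF u'] lt_nu_subset by blast
    qed
  qed
  \<comment> \<open>All big proper extensions of the given node. Under \<open>Q\<close>, which
    relates comparable ones of equal top value, each node has fewer than \<nu> predecessors by
    \<open>fibre\<close>.\<close>
  define Z where "Z = {node b' h' | b' h'. b \<prec> b' \<and> big R (node b' h') \<and> (\<forall>c. c \<preceq> b \<longrightarrow> h' c = h c)}"
  define Q where "Q = {(s, t). s \<in> Z \<and> t \<in> Z \<and> (s, t) \<in> tlt \<and> lastval s = lastval t}"
  have "wf Q"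
    by (rule wf_subset[OF wf_tlt]) (auto simp: Q_def)
  moreover have "lt_nu {s. (s, t) \<in> Q}" for t
  proof (cases "t \<in> Z")
    case True
    then obtain b' h' where t: "t = node b' h'" "b \<prec> b'" "big R (node b' h')" "\<forall>c. c \<preceq> b \<longrightarrow> h' c = h c"
      unfolding Z_def by blast
    have "{s. (s, t) \<in> Q} \<subseteq> (\<lambda>a. node a h') ` {a. b \<prec> a \<and> a \<preceq> b' \<and> h' a = h' b'}"
    proof
      fix s assume "s \<in> {s. (s, t) \<in> Q}"
      then have s: "s \<in> Z" "(s, t) \<in> tlt" "lastval s = lastval t"
        by (auto simp: Q_def)
      then obtain a where a: "a \<prec> b'" "s = node a h'"
        using t(1) tlt_node by blast
      moreover have "b \<prec> a"
        using s(1) a(2) by (auto simp: Z_def node_eq_iff)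
      ultimately show "s \<in> (\<lambda>a. node a h') ` {a. b \<prec> a \<and> a \<preceq> b' \<and> h' a = h' b'}"
        using s(3) t(1) by (auto simp: k.less_imp_le)
    qed
    moreover have "lt_nu ((\<lambda>a. node a h') ` {a. b \<prec> a \<and> a \<preceq> b' \<and> h' a = h' b'})"
      by (intro lt_nu_image fibre t)
    ultimately show ?thesis
      by (rule lt_nu_subset)
  next
    case False
    then show ?thesis
      by (simp add: Q_def lt_nu_finite)
  qed
  ultimately obtain col :: "'k \<Rightarrow> 'n" where col: "\<And>s t. (s, t) \<in> Q \<Longrightarrow> col s \<noteq> col t"
    using ex_colouring[of Q] by blast
  \<comment> \<open>Equal top value and equal colour exclude comparability, so the \<nu> cells are
    antichains.\<close>
  let ?cell = "\<lambda>p. {z \<in> Z. lastval z = fst p \<and> col z = snd p}"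
  have "Z = (\<Union>p\<in>UNIV \<times> UNIV. ?cell p)"
    by auto
  moreover have "le_nu (\<Union>p\<in>UNIV \<times> UNIV. ?cell p)"
  proof (rule le_nu_UN)
    have opt: "(UNIV :: 'n option set) = range Some \<union> {None}"
      by (auto simp: UNIV_option_conv)
    have "le_nu (UNIV :: 'n option set)"
      unfolding opt by (intro le_nu_Un le_nu_image le_nu_UNIV le_nu_finite[of "{None}"]) simp
    then show "le_nu (UNIV \<times> UNIV :: ('n option \<times> 'n) set)"
      using le_nu_UNIV by (rule le_nu_Times)
    show "le_nu (?cell p)" for p
    proof (rule big_antichain)
      show "big R t" if "t \<in> ?cell p" for t
        using that by (auto simp: Z_def)
      show "(s, t) \<notin> tlt" if "s \<in> ?cell p" "t \<in> ?cell p" for s t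
        using that col[of s t] by (auto simp: Q_def)
    qed
  qed
  ultimately have "le_nu Z"
    by simp
  then have "le_nu (lev ` Z \<union> {a. a \<preceq> b})"
    by (intro le_nu_Un le_nu_image le_nu_atMost)
  \<comment> \<open>But \<open>Z\<close> meets every level beyond \<open>b\<close>, and there are
    \<kappa> of these.\<close>
  moreover have "lev ` Z \<union> {a. a \<preceq> b} = UNIV"
  proof -
    have "c \<in> lev ` Z" if "b \<prec> c" for c
    proof -
      obtain h' where "big R (node c h')" "\<forall>a. a \<preceq> b \<longrightarrow> h' a = h a"
        using big_above[OF assms k.less_imp_le[OF \<open>b \<prec> c\<close>]] by blast
      then have "node c h' \<in> Z"
        using \<open>b \<prec> c\<close> by (auto simp: Z_def)
      then show ?thesis
        using lev_node by (metis imageI)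
    qed
    then show ?thesis
      using k.not_le by blast
  qed
  ultimately show False
    using not_le_nu_UNIV by simp
qed

text \<open>The big nodes that jump for the first time beyond \<open>a\<close> form an antichain, so
  their levels are bounded by some \<open>b\<close>. A big node at level \<open>b\<close> or higher
  has a big extension with a jump; the first jump of the extension beyond \<open>a\<close> occurs
  below \<open>b\<close>, hence already in the node itself.\<close>

lemma big_jumps_cofinal:
  "\<exists>b. \<forall>c h. b \<preceq> c \<longrightarrow> big R (node c h) \<longrightarrow> (\<exists>d. a \<prec> d \<and> d \<prec> c \<and> h d = None)"
proof -
  define D where "D = {node b h | b h. a \<prec> b \<and> big R (node b h) \<and> h b = None \<and>
    (\<forall>d. a \<prec> d \<longrightarrow> d \<prec> b \<longrightarrow> h d \<noteq> None)}"
  have "le_nu D"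
  proof (rule big_antichain)
    show "(s, t) \<notin> tlt" if "s \<in> D" "t \<in> D" for s t
      using that by (auto simp: D_def tlt_iff)
  qed (auto simp: D_def)
  then have "le_nu (lev ` D \<union> {a})"
    using le_nu_Un[OF le_nu_image[of D lev] le_nu_finite[of "{a}"]] by simp
  from k_bounded[OF this] obtain b where b: "\<And>t. t \<in> D \<Longrightarrow> lev t \<prec> b" "a \<prec> b"
    by auto
  have "\<exists>d. a \<prec> d \<and> d \<prec> c \<and> h d = None" if "b \<preceq> c" and big: "big R (node c h)" for c h
  proof -
    obtain c' h' where h': "c \<prec> c'" "big R (node c' h')" "\<forall>e. e \<preceq> c \<longrightarrow> h' e = h e" "h' c' = None"
      using big_jump_above[OF big] by blast
    have "a \<prec> c'"
      using b(2) that(1) h'(1) by (meson k.less_le_trans k.less_trans)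
    with h'(4) have "a \<prec> c' \<and> h' c' = None"
      by simp
    then obtain d where d: "a \<prec> d \<and> h' d = None" "\<And>e. e \<prec> d \<Longrightarrow> \<not> (a \<prec> e \<and> h' e = None)"
      by (rule k_least[of "\<lambda>d. a \<prec> d \<and> h' d = None"]) blast
    have "d \<preceq> c'"
      using d(2)[of c'] \<open>a \<prec> c' \<and> h' c' = None\<close> k.not_le by blast
    then have "node d h' \<in> D"
      unfolding D_def using d big_mono[OF h'(2)]
      by (intro CollectI exI[of _ d] exI[of _ h'] conjI refl) auto
    then have "d \<prec> b"
      using b(1)[of "node d h'"] by simp
    then have "d \<prec> c"
      using that(1) by (rule k.less_le_trans)
    moreover have "h d = None"
      using h'(3) k.less_imp_le[OF \<open>d \<prec> c\<close>] d(1) by simp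
    ultimately show ?thesis
      using d(1) by blast
  qed
  then show ?thesis
    by blast
qed

text \<open>At a closure point \<open>c\<close> of \<open>F\<close> the jumps of a big node are
  cofinal below \<open>c\<close>, so waiting is impossible and the node jumps at \<open>c\<close>.
  Then \<open>x c\<close> is its code, so it is the only big node of its level, and these nodes form
  an unbounded chain.\<close>

lemma branching_of_souslin: "x \<in> branching"
proof -
  obtain F where F: "\<And>a c h. F a \<preceq> c \<Longrightarrow> big R (node c h) \<Longrightarrow> \<exists>d. a \<prec> d \<and> d \<prec> c \<and> h d = None"
    using big_jumps_cofinal by metis
  \<comment> \<open>The least point is excluded because a jump there needs no code.\<close>
  define E where "E = {c. c \<noteq> k0 \<and> (\<forall>d. d \<prec> c \<longrightarrow> F d \<prec> c)}"
  have unique: "x c = node c h" if "c \<in> E" and big: "big R (node c h)" for c h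
  proof -
    have okp: "okp x c h"
      using big_in_tree[OF big] by (simp add: node_in_tree ok_def)
    have "h c = None"
    proof (rule ccontr)
      assume "h c \<noteq> None"
      with okp obtain u d where d: "d \<prec> c" "\<And>a. d \<prec> a \<Longrightarrow> a \<preceq> c \<Longrightarrow> h a = Some (u a)"
        unfolding okp_def by blast
      then have "F d \<preceq> c"
        using \<open>c \<in> E\<close> k.less_imp_le by (auto simp: E_def)
      from F[OF this big] show False
        using d(2) k.less_imp_le by fastforce
    qed
    then show ?thesis
      using jump_cases[OF okp] \<open>c \<in> E\<close> by (simp add: E_def)
  qed
  let ?B = "{node c h | c h. c \<in> E \<and> big R (node c h)}"
  show ?thesis
  proof (rule unbounded_chain_branching[of ?B])
    show "?B \<subseteq> tree x"
      using big_in_tree by blast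
    have le: "s = t \<or> (s, t) \<in> tlt" 
      if "s = node c h" "c \<in> E" "big R s" "t = node c' h'" "big R t" "c \<preceq> c'" for s t c h c' h'
    proof -
      have "big R (node c h')"
        using big_mono that by blast
      then have "s = node c h'"
        using unique[OF \<open>c \<in> E\<close>] that by metis
      then show ?thesis
        using that by (auto simp: tlt_node k.le_less)
    qed
    show "s = t \<or> (s, t) \<in> tlt \<or> (t, s) \<in> tlt" if st: "s \<in> ?B" "t \<in> ?B" for s t
    proof -
      obtain c h c' h' where "s = node c h" "c \<in> E" "big R s" "t = node c' h'" "c' \<in> E" "big R t"
        using st by auto
      then show ?thesis
        using le[of s c h t c' h'] le[of t c' h' s c h] k.linear[of c c'] by blast
    qed
    show "\<exists>b h. c \<preceq> b \<and> node b h \<in> ?B" for c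
    proof -
      obtain b where "c \<prec> b" "\<And>d. d \<prec> b \<Longrightarrow> F d \<prec> b"
        using ex_closed[of c F] by blast
      then have "c \<preceq> b" "b \<in> E"
        using k0_le k.not_le by (auto simp: E_def k.less_imp_le)
      then show ?thesis
        using big_ex[of b] by blast
    qed
  qed
qed

end

lemma no_souslin_subtree:
  assumes "x \<notin> branching" "S \<subseteq> tree x"
  shows "\<not> kappa_souslin r S (Restr (tord x) S)"
proof
  assume S: "kappa_souslin r S (Restr (tord x) S)"
  have "tlevel r S (Restr (tord x) S) b \<noteq> {}" for b
    using S unfolding kappa_souslin_def kappa_aronszajn_def height_kappa_tree_def by blast
  then have "\<exists>t. t \<in> tlevel r S (Restr (tord x) S) b" for b
    by blast
  \<comment> \<open>One node from each level: different levels give different nodes, so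
    \<open>S\<close> has more than \<nu> elements.\<close>
  then obtain f where f: "\<And>b. f b \<in> tlevel r S (Restr (tord x) S) b"
    by metis
  have "inj f"
  proof (rule injI)
    fix a b assume "f a = f b"
    then have "Restr r (underS r a) =o Restr r (underS r b)"
      using f[of a] f[of b] unfolding tlevel_def
      by (auto dest: ordIso_symmetric intro: ordIso_transitive)
    then show "a = b"
      by (rule Restr_underS_inj)
  qed
  then have "\<not> le_nu (range f)"
    using not_le_nu_UNIV le_nu_image[of "range f" "inv f"] by auto
  moreover have "range f \<subseteq> S"
    using f by (auto simp: tlevel_def)
  ultimately have "\<not> le_nu S"
    using le_nu_subset by blast
  moreover have "le_nu X" if "X \<subseteq> S" "\<And>s t. s \<in> X \<Longrightarrow> t \<in> X \<Longrightarrow> (s, t) \<notin> tlt" for X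
    using S that unfolding kappa_souslin_def less_nu_iff[symmetric] by (auto simp: is_antichain_def)
  ultimately show False
    using branching_of_souslin[OF assms(2)] assms(1) by blast
qed

subsection \<open>Definability\<close>

lemma Nb_iff: "g \<in> Nb r b f \<longleftrightarrow> (\<forall>a. a \<prec> b \<longrightarrow> g a = f a)"
  by (simp add: Nb_def underS_r)

lemma kclosed2I:
  assumes "\<And>f g. (f, g) \<notin> C \<Longrightarrow>
    \<exists>b. \<forall>f' g'. (\<forall>a. a \<prec> b \<longrightarrow> f' a = f a) \<longrightarrow> (\<forall>a. a \<prec> b \<longrightarrow> g' a = g a) \<longrightarrow> (f', g') \<notin> C"
  shows "kclosed2 r C"
proof -
  have "\<exists>b1 b2. Nb r b1 f \<times> Nb r b2 g \<subseteq> - C" if "(f, g) \<in> - C" for f g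
  proof -
    obtain b where "\<forall>f' g'. (\<forall>a. a \<prec> b \<longrightarrow> f' a = f a) \<longrightarrow> (\<forall>a. a \<prec> b \<longrightarrow> g' a = g a) \<longrightarrow> (f', g') \<notin> C"
      using assms[of f g] \<open>(f, g) \<in> - C\<close> by auto
    then have "Nb r b f \<times> Nb r b g \<subseteq> - C"
      by (auto simp: Nb_iff)
    then show ?thesis
      by blast
  qed
  then show ?thesis
    unfolding kclosed2_def kopen2_def by auto
qed

lemma Sigma11_branching: "Sigma11 r branching"
proof -
  \<comment> \<open>The second coordinate carries the branch: \<open>lastval\<close> decodes
    \<open>y a\<close> to the value at \<open>a\<close>. Failure at \<open>c\<close> depends only on
    coordinates up to \<open>c\<close>, so \<open>C\<close> is closed.\<close>
  define C where "C = {(x, y). \<forall>c. okp x c (\<lambda>a. lastval (y a))}"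
  have "kclosed2 r C"
  proof (rule kclosed2I)
    fix x y assume "(x, y) \<notin> C"
    then obtain c where c: "\<not> okp x c (\<lambda>a. lastval (y a))"
      by (auto simp: C_def)
    obtain b where b: "c \<prec> b"
      using kless_ex by blast
    have "(x', y') \<notin> C" if "\<forall>a. a \<prec> b \<longrightarrow> x' a = x a" "\<forall>a. a \<prec> b \<longrightarrow> y' a = y a" for x' y'
    proof -
      have "okp x' c (\<lambda>a. lastval (y' a)) \<longleftrightarrow> okp x c (\<lambda>a. lastval (y a))"
        using that b by (intro okp_cong) (auto dest: k.le_less_trans)
      then show ?thesis
        using c by (auto simp: C_def)
    qed
    then show "\<exists>b. \<forall>x' y'. (\<forall>a. a \<prec> b \<longrightarrow> x' a = x a) \<longrightarrow> (\<forall>a. a \<prec> b \<longrightarrow> y' a = y a) \<longrightarrow> (x', y') \<notin> C"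
      by blast
  qed
  moreover have "branching = fst ` C"
  proof
    show "branching \<subseteq> fst ` C"
    proof
      fix x assume "x \<in> branching"
      then obtain h where h: "\<And>c. okp x c h"
        unfolding branching_def by blast
      have "(x, \<lambda>a. node k0 (\<lambda>_. h a)) \<in> C"
        using h by (simp add: C_def)
      then show "x \<in> fst ` C"
        by (rule rev_image_eqI) simp
    qed
    show "fst ` C \<subseteq> branching"
    proof
      fix x assume "x \<in> fst ` C"
      then obtain y where "(x, y) \<in> C"
        by force
      then show "x \<in> branching"
        unfolding C_def branching_def by blast
    qed
  qed
  ultimately show ?thesis
    unfolding Sigma11_def by blast
qed

text \<open>Along a branch, which has length \<kappa>, the function \<open>s\<close> would be
  injective into \<nu>.\<close>

lemma not_branching_if_special:
  fixes s :: "'k \<Rightarrow> 'n"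
  assumes s: "\<And>t u. u \<in> tree x \<Longrightarrow> (t, u) \<in> tlt \<Longrightarrow> s t \<noteq> s u"
  shows "x \<notin> branching"
proof
  assume "x \<in> branching"
  then obtain h where h: "\<And>c. okp x c h"
    unfolding branching_def by blast
  have ne: "s (node a h) \<noteq> s (node b h)" if "a \<prec> b" for a b
    using h that by (intro s) (auto simp: node_in_tree ok_def tlt_iff)
  have "inj (\<lambda>a. s (node a h))"
  proof (rule injI)
    fix a b assume "s (node a h) = s (node b h)"
    then show "a = b"
      using ne[of a b] ne[of b a] k.less_linear[of a b] by auto
  qed
  then have "le_nu (UNIV :: 'k set)"
    unfolding le_nu_iff card_of_ordLeq[symmetric] by blast
  then show False
    using not_le_nu_UNIV by simp
qed

lemma special_if_not_branching:
  assumes hyp: "\<forall>(T :: 'k set) lt. kappa_aronszajn r T lt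
                 \<and> \<not> (\<exists>S \<subseteq> T. kappa_souslin r S (Restr lt S))
               \<longrightarrow> (\<exists>s :: 'k \<Rightarrow> 'n. \<forall>C \<subseteq> T. is_chain lt C \<longrightarrow> inj_on s C)"
    and x: "x \<notin> branching"
  shows "\<exists>s :: 'k \<Rightarrow> 'n. \<forall>t u. u \<in> tree x \<longrightarrow> (t, u) \<in> tlt \<longrightarrow> s t \<noteq> s u"
proof -
  obtain s :: "'k \<Rightarrow> 'n" where s: "\<And>C. C \<subseteq> tree x \<Longrightarrow> is_chain (tord x) C \<Longrightarrow> inj_on s C"
    using hyp aronszajn_tree[OF x] no_souslin_subtree[OF x] by blast
  have "s t \<noteq> s u" if "u \<in> tree x" "(t, u) \<in> tlt" for t u
  proof -
    have "t \<in> tree x"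
      using that tlt_in_tree by blast
    then have "inj_on s {t, u}"
      using that by (intro s) (auto simp: is_chain_def)
    moreover have "t \<noteq> u"
      using that(2) irrefl_tlt by auto
    ultimately show ?thesis
      by (simp add: inj_on_def)
  qed
  then show ?thesis
    by blast
qed

lemma Sigma11_not_branching:
  assumes hyp: "\<forall>(T :: 'k set) lt. kappa_aronszajn r T lt
                 \<and> \<not> (\<exists>S \<subseteq> T. kappa_souslin r S (Restr lt S))
               \<longrightarrow> (\<exists>s :: 'k \<Rightarrow> 'n. \<forall>C \<subseteq> T. is_chain lt C \<longrightarrow> inj_on s C)"
  shows "Sigma11 r (- branching)"
proof -
  define val where "val t = the (lastval t)" for t
  \<comment> \<open>The second coordinate carries a specialising function. A clash at
    \<open>t\<close> and \<open>u\<close> is visible below any strict bound of \<open>t\<close>,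
    \<open>u\<close> and the level of \<open>u\<close>, because \<open>u \<in> tree x\<close>
    depends on \<open>x\<close> up to that level only.\<close>
  define C where "C = {(x, y). \<forall>t u. u \<in> tree x \<longrightarrow> (t, u) \<in> tlt \<longrightarrow> val (y t) \<noteq> val (y u)}"
  have "kclosed2 r C"
  proof (rule kclosed2I)
    fix x y assume "(x, y) \<notin> C"
    then obtain t u where tu: "u \<in> tree x" "(t, u) \<in> tlt" "val (y t) = val (y u)"
      by (auto simp: C_def)
    then obtain c h where u: "u = node c h" "ok x c h"
      using tree_cases by blast
    obtain b where b: "c \<prec> b" "t \<prec> b" "u \<prec> b"
      using k_bounded[of "{c, t, u}"] le_nu_finite[of "{c, t, u}"] by auto
    have "(x', y') \<notin> C" if "\<forall>a. a \<prec> b \<longrightarrow> x' a = x a" "\<forall>a. a \<prec> b \<longrightarrow> y' a = y a" for x' y'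
    proof -
      have "ok x' c h \<longleftrightarrow> ok x c h"
        using that b by (intro ok_cong) (auto dest: k.le_less_trans)
      then have "u \<in> tree x'"
        using u by (simp add: node_in_tree)
      moreover have "val (y' t) = val (y' u)"
        using that b tu(3) by simp
      ultimately show ?thesis
        using tu(2) by (auto simp: C_def)
    qed
    then show "\<exists>b. \<forall>x' y'. (\<forall>a. a \<prec> b \<longrightarrow> x' a = x a) \<longrightarrow> (\<forall>a. a \<prec> b \<longrightarrow> y' a = y a) \<longrightarrow> (x', y') \<notin> C"
      by blast
  qed
  moreover have "- branching = fst ` C"
  proof
    show "- branching \<subseteq> fst ` C"
    proof
      fix x assume "x \<in> - branching"
      then obtain s :: "'k \<Rightarrow> 'n" where s: "\<forall>t u. u \<in> tree x \<longrightarrow> (t, u) \<in> tlt \<longrightarrow> s t \<noteq> s u"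
        using special_if_not_branching[OF hyp] by blast
      have "(x, \<lambda>t. node k0 (\<lambda>_. Some (s t))) \<in> C"
        using s by (simp add: C_def val_def)
      then show "x \<in> fst ` C"
        by (rule rev_image_eqI) simp
    qed
    show "fst ` C \<subseteq> - branching"
    proof
      fix x assume "x \<in> fst ` C"
      then obtain y where "(x, y) \<in> C"
        by force
      then have "val (y t) \<noteq> val (y u)" if "u \<in> tree x" "(t, u) \<in> tlt" for t u
        using that by (simp add: C_def)
      then show "x \<in> - branching"
        using not_branching_if_special[of x "\<lambda>t. val (y t)"] by blast
    qed
  qed
  ultimately show ?thesis
    unfolding Sigma11_def by blast
qed

subsection \<open>Failure of the Baire property\<close>

lemma nowhere_dense_avoid:
  assumes "nowhere_dense r M"
  shows "\<exists>d g. b \<prec> d \<and> (\<forall>a. a \<prec> b \<longrightarrow> g a = f a) \<and> Nb r d g \<inter> M = {}"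
proof -
  have "\<not> Nb r b f \<subseteq> kclosure r M"
    using assms unfolding nowhere_dense_def kinterior_def by blast
  then obtain g where g: "g \<in> Nb r b f" "g \<in> kinterior r (- M)"
    unfolding kclosure_def by blast
  then obtain c where c: "Nb r c g \<subseteq> - M"
    unfolding kinterior_def by blast
  obtain d where d: "b \<prec> d" "c \<prec> d"
    using k_bounded[of "{b, c}"] le_nu_finite[of "{b, c}"] by auto
  have "Nb r d g \<subseteq> Nb r c g"
    using d(2) by (auto simp: Nb_iff intro: k.less_trans)
  then have "Nb r d g \<inter> M = {}"
    using c by blast
  then show ?thesis
    using d(1) g(1) by (auto simp: Nb_iff)
qed

text \<open>A recursion of length \<kappa>. Stage \<open>a\<close> takes the least \<open>g\<close>
  at or above \<open>b0\<close> and all earlier lengths, sets the value at \<open>g\<close> as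
  \<open>\<Phi>\<close> dictates, and extends to a length \<open>d\<close> so as to avoid
  \<open>M a\<close>. Leastness of \<open>g\<close> makes the set of these free places closed as
  well as unbounded.\<close>

lemma ex_generic:
  fixes M :: "'k \<Rightarrow> ('k \<Rightarrow> 'k) set" and \<Phi> :: "'k \<Rightarrow> 'k set \<Rightarrow> 'k"
  assumes M: "\<And>a. nowhere_dense r (M a)"
  obtains x \<Gamma> where "x \<in> Nb r b0 x0" "\<And>a. x \<notin> M a"
    "\<And>c. c \<in> \<Gamma> \<Longrightarrow> x c = \<Phi> c {c' \<in> \<Gamma>. c' \<prec> c}"
    "\<And>a. \<exists>c\<in>\<Gamma>. a \<prec> c"
    "\<And>c. c \<noteq> k0 \<Longrightarrow> (\<And>a. a \<prec> c \<Longrightarrow> \<exists>c'\<in>\<Gamma>. a \<prec> c' \<and> c' \<prec> c) \<Longrightarrow> c \<in> \<Gamma>"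
proof -
  \<comment> \<open>The triple chosen at stage \<open>a\<close>: the free place \<open>g\<close>,
    the new length \<open>d\<close>, and a function \<open>f\<close> that matters below
    \<open>d\<close> only.\<close>
  define P where "P p a q \<longleftrightarrow> (case q of (g, d, f) \<Rightarrow>
      b0 \<preceq> g \<and> (\<forall>b. b \<prec> a \<longrightarrow> fst (snd (p b)) \<preceq> g) \<and>
      (\<forall>c. b0 \<preceq> c \<and> (\<forall>b. b \<prec> a \<longrightarrow> fst (snd (p b)) \<preceq> c) \<longrightarrow> g \<preceq> c) \<and> g \<prec> d \<and>
      (\<forall>c. c \<prec> b0 \<longrightarrow> f c = x0 c) \<and>
      (\<forall>b c. b \<prec> a \<longrightarrow> c \<prec> fst (snd (p b)) \<longrightarrow> f c = snd (snd (p b)) c) \<and>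
      f g = \<Phi> g (fst ` p ` {b. b \<prec> a}) \<and> Nb r d f \<inter> M a = {})"
    for p :: "'k \<Rightarrow> 'k \<times> 'k \<times> ('k \<Rightarrow> 'k)" and a q
  have "\<exists>p. \<forall>a. P p a (p a)"
  proof (rule dependent_wf_choice[OF wf_kless])
    show "P p a q = P p' a q" if "\<And>z. (z, a) \<in> {(a, b). a \<prec> b} \<Longrightarrow> p z = p' z" for p p' a q
    proof -
      have "p b = p' b" if "b \<prec> a" for b
        using \<open>\<And>z. (z, a) \<in> {(a, b). a \<prec> b} \<Longrightarrow> p z = p' z\<close> that by simp
      moreover from this have "p ` {b. b \<prec> a} = p' ` {b. b \<prec> a}"
        by (intro image_cong) auto
      ultimately show ?thesis
        unfolding P_def by (simp cong: conj_cong imp_cong)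
    qed
    show "\<exists>q. P p a q" if "\<And>b. (b, a) \<in> {(a, b). a \<prec> b} \<Longrightarrow> P p b (p b)" for p a
    proof -
      define D where "D b = fst (snd (p b))" for b
      define f where "f b = snd (snd (p b))" for b
      have old: "\<And>c. c \<prec> b0 \<Longrightarrow> f b c = x0 c" "\<And>b' c. b' \<prec> b \<Longrightarrow> c \<prec> D b' \<Longrightarrow> f b c = f b' c"
        if "b \<prec> a" for b
        using \<open>\<And>b. (b, a) \<in> {(a, b). a \<prec> b} \<Longrightarrow> P p b (p b)\<close>[of b] that
        by (auto simp: P_def D_def f_def split: prod.splits)
      have "le_nu (D ` {b. b \<prec> a} \<union> {b0})"
        by (intro le_nu_Un le_nu_image le_nu_below le_nu_finite[of "{b0}"]) simp
      from k_bounded[OF this] obtain b1 where "\<forall>d\<in>D ` {b. b \<prec> a} \<union> {b0}. d \<prec> b1" ..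
      then have "b0 \<preceq> b1 \<and> (\<forall>b. b \<prec> a \<longrightarrow> D b \<preceq> b1)"
        by (simp add: k.less_imp_le)
      then obtain g where g: "b0 \<preceq> g \<and> (\<forall>b. b \<prec> a \<longrightarrow> D b \<preceq> g)"
          "\<And>c. c \<prec> g \<Longrightarrow> \<not> (b0 \<preceq> c \<and> (\<forall>b. b \<prec> a \<longrightarrow> D b \<preceq> c))"
        by (rule k_least) blast
      define F where "F c = (if c \<prec> b0 then x0 c else if \<exists>b. b \<prec> a \<and> c \<prec> D b
        then f (SOME b. b \<prec> a \<and> c \<prec> D b) c else \<Phi> g (fst ` p ` {b. b \<prec> a}))" for c
      have F_old: "F c = f b c" if b: "b \<prec> a" "c \<prec> D b" for b c
      proof (cases "c \<prec> b0")
        case True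
        then show ?thesis
          using old(1)[OF b(1)] by (simp add: F_def)
      next
        case False
        define b' where "b' = (SOME b. b \<prec> a \<and> c \<prec> D b)"
        have b': "b' \<prec> a" "c \<prec> D b'"
          unfolding b'_def using someI[of "\<lambda>b. b \<prec> a \<and> c \<prec> D b"] b by blast+
        have "F c = f b' c"
          unfolding F_def b'_def using False b by auto
        moreover have "f b' c = f b c"
          using old(2)[OF b(1), of b' c] old(2)[OF b'(1), of b c] b b' k.less_linear[of b b'] by auto
        ultimately show ?thesis
          by simp
      qed
      have F_g: "F g = \<Phi> g (fst ` p ` {b. b \<prec> a})"
        using g(1) by (auto simp: F_def k.not_less[symmetric])
      \<comment> \<open>The avoiding extension starts above \<open>g\<close>, so that the value at
        \<open>g\<close> survives.\<close>
      obtain g' where g': "g \<prec> g'"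
        using kless_ex by blast
      obtain d f' where f': "g' \<prec> d" "\<And>c. c \<prec> g' \<Longrightarrow> f' c = F c" "Nb r d f' \<inter> M a = {}"
        using nowhere_dense_avoid[OF M, of g' F a] by blast
      have "P p a (g, d, f')"
        unfolding P_def D_def[symmetric] f_def[symmetric] prod.case
      proof (intro conjI allI impI)
        show "g \<preceq> c" if "b0 \<preceq> c \<and> (\<forall>b. b \<prec> a \<longrightarrow> D b \<preceq> c)" for c
          using g(2)[of c] that k.not_le by blast
        show "g \<prec> d"
          using g' f'(1) by (rule k.less_trans)
        show "f' c = x0 c" if "c \<prec> b0" for c
        proof -
          have "c \<prec> g'"
            using that g(1) g' by (meson k.less_le_trans k.less_trans)
          then show ?thesis
            using that by (simp add: f'(2) F_def)
        qed
        show "f' c = f b c" if "b \<prec> a" "c \<prec> D b" for b c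
        proof -
          have "c \<prec> g'"
            using that g(1) g' by (meson k.less_le_trans k.less_trans)
          then show ?thesis
            using that by (simp add: f'(2) F_old)
        qed
        show "f' g = \<Phi> g (fst ` p ` {b. b \<prec> a})"
          using f'(2)[OF g'] F_g by simp
      qed (use g(1) f'(3) in blast)+
      then show ?thesis
        by blast
    qed
  qed
  then obtain p where p: "\<And>a. P p a (p a)"
    by blast
  define G where "G a = fst (p a)" for a
  define D where "D a = fst (snd (p a))" for a
  define f where "f a = snd (snd (p a))" for a
  have p: "b0 \<preceq> G a" "\<And>b. b \<prec> a \<Longrightarrow> D b \<preceq> G a"
      "\<And>c. b0 \<preceq> c \<Longrightarrow> (\<And>b. b \<prec> a \<Longrightarrow> D b \<preceq> c) \<Longrightarrow> G a \<preceq> c"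
      "G a \<prec> D a" "\<And>c. c \<prec> b0 \<Longrightarrow> f a c = x0 c"
      "\<And>b c. b \<prec> a \<Longrightarrow> c \<prec> D b \<Longrightarrow> f a c = f b c"
      "f a (G a) = \<Phi> (G a) (G ` {b. b \<prec> a})" "Nb r (D a) (f a) \<inter> M a = {}" for a
    using p[of a] by (auto simp: P_def G_def D_def f_def image_image split: prod.splits)
  have G_mono: "G b \<prec> G a" if "b \<prec> a" for a b
    using p(4)[of b] p(2)[OF that] by (rule k.less_le_trans)
  have G_less: "b \<prec> a" if "G b \<prec> G a" for a b
    using that G_mono[of a b] k.less_linear[of a b] k.less_asym by auto
  have G_ge: "a \<preceq> G a" for a
  proof (induction a rule: k.less_induct)
    case (less a)
    show ?case
    proof (rule ccontr)
      assume "\<not> a \<preceq> G a"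
      then have "G a \<prec> a"
        by (simp add: k.not_le)
      then show False
        using less.IH[of "G a"] G_mono[of "G a" a] k.not_le by blast
    qed
  qed
  \<comment> \<open>Stage \<open>c\<close> has already decided the value at \<open>c\<close>, since
    \<open>c \<preceq> G c\<close> and \<open>G c \<prec> D c\<close>; later stages keep it.\<close>
  define x where "x c = f c c" for c
  have x: "x c = f a c" if "c \<prec> D a" for a c
  proof -
    have "c \<prec> D c"
      using G_ge p(4) by (rule k.le_less_trans)
    then show ?thesis
      unfolding x_def using p(6)[of a c c] p(6)[of c a c] that k.less_linear[of a c] by auto
  qed
  show thesis
  proof
    show "x \<in> Nb r b0 x0"
      using p(5) by (simp add: Nb_iff x_def)
    show "x \<notin> M a" for a
    proof -
      have "x \<in> Nb r (D a) (f a)"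
        using x by (simp add: Nb_iff)
      then show ?thesis
        using p(8) by blast
    qed
    show "x c = \<Phi> c {c' \<in> range G. c' \<prec> c}" if "c \<in> range G" for c
    proof -
      obtain a where a: "c = G a"
        using \<open>c \<in> range G\<close> by (rule rangeE)
      have "{c' \<in> range G. c' \<prec> c} = G ` {b. b \<prec> a}"
      proof -
        have "G b \<prec> G a \<longleftrightarrow> b \<prec> a" for b
          using G_mono G_less by blast
        then show ?thesis
          unfolding a by blast
      qed
      then show ?thesis
        using x[OF p(4)[of a]] p(7)[of a] by (simp add: a)
    qed
    show "\<exists>c\<in>range G. a \<prec> c" for a
    proof -
      obtain b where "a \<prec> b"
        using kless_ex by blast
      then have "a \<prec> G b"
        using G_ge by (rule k.less_le_trans)
      then show ?thesis
        by blast
    qed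
    show "c \<in> range G" if "c \<noteq> k0" and lim: "\<And>a. a \<prec> c \<Longrightarrow> \<exists>c'\<in>range G. a \<prec> c' \<and> c' \<prec> c" for c
    proof -
      \<comment> \<open>Let \<open>a\<close> be the first stage with \<open>G a\<close> not below
        \<open>c\<close>. All earlier lengths are at most \<open>c\<close>, because the free places
        are cofinal below \<open>c\<close>; leastness of \<open>G a\<close> then gives
        \<open>G a = c\<close>.\<close>
      obtain a where a: "c \<preceq> G a" "\<And>b. b \<prec> a \<Longrightarrow> \<not> c \<preceq> G b"
        using G_ge[of c] by (rule k_least) blast
      have "k0 \<prec> c"
        using k0_le \<open>c \<noteq> k0\<close> k.le_less by blast
      then obtain b where "G b \<prec> c"
        using lim by blast
      then have "b0 \<preceq> c"
        using p(1)[of b] by (meson k.le_less_trans k.less_imp_le)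
      moreover have "D b \<preceq> c" if b: "b \<prec> a" for b
      proof -
        have "G b \<prec> c"
          using a(2)[OF b] by (simp add: k.not_le)
        then obtain b' where b': "G b \<prec> G b'" "G b' \<prec> c"
          using lim by blast
        have "D b \<preceq> G b'"
          using G_less[OF b'(1)] by (rule p(2))
        then show ?thesis
          using b'(2) by (meson k.le_less_trans k.less_imp_le)
      qed
      ultimately have "G a \<preceq> c"
        by (rule p(3))
      then show ?thesis
        using a(1) k.order_antisym by blast
    qed
  qed
qed

section \<open>A branch with prescribed jumps\<close>

definition nxt :: "'k set \<Rightarrow> 'k \<Rightarrow> 'k" where
  "nxt G c = (SOME b. b \<in> G \<and> c \<prec> b \<and> (\<forall>b'. b' \<in> G \<longrightarrow> c \<prec> b' \<longrightarrow> b \<preceq> b'))"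

lemma nxt_eqI:
  assumes "b \<in> G" "c \<prec> b" "\<And>b'. b' \<in> G \<Longrightarrow> c \<prec> b' \<Longrightarrow> b \<preceq> b'"
  shows "nxt G c = b"
  unfolding nxt_def
proof (rule some_equality)
  fix b' assume "b' \<in> G \<and> c \<prec> b' \<and> (\<forall>b. b \<in> G \<longrightarrow> c \<prec> b \<longrightarrow> b' \<preceq> b)"
  then show "b' = b"
    using assms by (intro k.order_antisym) auto
qed (use assms in auto)

lemma nxt:
  assumes "b \<in> G" "c \<prec> b"
  shows "nxt G c \<in> G" "c \<prec> nxt G c" "\<And>b'. b' \<in> G \<Longrightarrow> c \<prec> b' \<Longrightarrow> nxt G c \<preceq> b'"
proof -
  have "b \<in> G \<and> c \<prec> b"
    using assms by simp
  then obtain d where d: "d \<in> G \<and> c \<prec> d" "\<And>d'. d' \<prec> d \<Longrightarrow> \<not> (d' \<in> G \<and> c \<prec> d')"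
    by (rule k_least[of "\<lambda>b. b \<in> G \<and> c \<prec> b"]) blast
  have min: "d \<preceq> b'" if "b' \<in> G" "c \<prec> b'" for b'
    using d(2)[of b'] that k.not_le by blast
  then have "nxt G c = d"
    using d(1) by (intro nxt_eqI) auto
  then show "nxt G c \<in> G" "c \<prec> nxt G c" "\<And>b'. b' \<in> G \<Longrightarrow> c \<prec> b' \<Longrightarrow> nxt G c \<preceq> b'"
    using d(1) min by auto
qed

text \<open>The weight of the next member of \<open>G\<close> is followed, so that a single waiting
  function fills each gap of \<open>G\<close>.\<close>

definition jumps_at :: "'k set \<Rightarrow> 'k \<Rightarrow> 'n option" where
  "jumps_at G c = (if c = k0 \<or> c \<in> G then None else Some (wt (nxt G c) c))"

text \<open>When the value of \<open>x\<close> at \<open>b\<close> is chosen, only the members of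
  \<open>G\<close> below \<open>b\<close> are known; adding \<open>b\<close> supplies the next
  member for the points after the last of them.\<close>

lemma jumps_at_initial:
  assumes "b \<in> G" "c \<preceq> b"
  shows "jumps_at (insert b {b' \<in> G. b' \<prec> b}) c = jumps_at G c"
proof (cases "c = k0 \<or> c \<in> G")
  case True
  then show ?thesis
    using assms by (auto simp: jumps_at_def k.le_less)
next
  case False
  then have cb: "c \<prec> b"
    using assms by (auto simp: k.le_less)
  note n = nxt[OF assms(1) cb]
  have "nxt G c \<prec> b \<or> nxt G c = b"
    using n(3)[OF assms(1) cb] k.le_less by blast
  then have "nxt (insert b {b' \<in> G. b' \<prec> b}) c = nxt G c"
    using n assms(1) by (intro nxt_eqI) auto
  then show ?thesis
    using False assms(1) by (auto simp: jumps_at_def)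
qed

text \<open>On the club \<Gamma> let \<open>x\<close> code the sequence \<open>jumps_at\<close>
  built from the past. Then \<open>jumps_at \<Gamma>\<close> is a branch: its jumps are licensed by
  \<open>x\<close>, and closedness of \<Gamma> provides a last jump before every point where it
  waits.\<close>

lemma comeagre_meets_branching:
  fixes M :: "'k \<Rightarrow> ('k \<Rightarrow> 'k) set"
  assumes "\<And>a. nowhere_dense r (M a)"
  shows "\<exists>x \<in> Nb r b0 x0. x \<in> branching \<and> (\<forall>a. x \<notin> M a)"
proof -
  obtain x \<Gamma> where x: "x \<in> Nb r b0 x0" "\<And>a. x \<notin> M a"
      and val: "\<And>c. c \<in> \<Gamma> \<Longrightarrow> x c = node c (jumps_at (insert c {c' \<in> \<Gamma>. c' \<prec> c}))"
      and unb: "\<And>a. \<exists>c\<in>\<Gamma>. a \<prec> c"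
      and closed: "\<And>c. c \<noteq> k0 \<Longrightarrow> (\<And>a. a \<prec> c \<Longrightarrow> \<exists>c'\<in>\<Gamma>. a \<prec> c' \<and> c' \<prec> c) \<Longrightarrow> c \<in> \<Gamma>"
    using ex_generic[where M = M and \<Phi> = "\<lambda>c G. node c (jumps_at (insert c G))", OF assms] by blast
  have "okp x c (jumps_at \<Gamma>)" for c
  proof (cases "c = k0 \<or> c \<in> \<Gamma>")
    case True
    then have "c = k0 \<or> x c = node c (jumps_at \<Gamma>)"
      using val jumps_at_initial by (auto simp: node_eq_iff)
    then show ?thesis
      using True by (auto simp: okp_def jumps_at_def)
  next
    case False
    \<comment> \<open>The supremum \<open>d\<close> of the members of \<Gamma> below
      \<open>c\<close> will be the last jump before \<open>c\<close>.\<close>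
    have "c \<preceq> c \<and> (\<forall>e\<in>\<Gamma>. e \<prec> c \<longrightarrow> e \<preceq> c)"
      using k.less_imp_le by simp
    then obtain d where d: "d \<preceq> c \<and> (\<forall>e\<in>\<Gamma>. e \<prec> c \<longrightarrow> e \<preceq> d)"
        "\<And>d'. d' \<prec> d \<Longrightarrow> \<not> (d' \<preceq> c \<and> (\<forall>e\<in>\<Gamma>. e \<prec> c \<longrightarrow> e \<preceq> d'))"
      by (rule k_least[of "\<lambda>d. d \<preceq> c \<and> (\<forall>e\<in>\<Gamma>. e \<prec> c \<longrightarrow> e \<preceq> d)"]) blast
    have d_jump: "d = k0 \<or> d \<in> \<Gamma>"
    proof (rule ccontr)
      assume not: "\<not> (d = k0 \<or> d \<in> \<Gamma>)"
      have "\<exists>c'\<in>\<Gamma>. a \<prec> c' \<and> c' \<prec> d" if a: "a \<prec> d" for a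
      proof -
        have "a \<preceq> c"
          using a d(1) by (meson k.less_imp_le k.order_trans)
        then obtain e where e: "e \<in> \<Gamma>" "e \<prec> c" "\<not> e \<preceq> a"
          using d(2)[OF a] by blast
        then have "e \<preceq> d" "e \<noteq> d" "a \<prec> e"
          using d(1) not by (auto simp: k.not_le)
        then show ?thesis
          using e(1) by (auto simp: k.le_less)
      qed
      then show False
        using closed[of d] not by blast
    qed
    then have dc: "d \<prec> c"
      using d(1) False by (auto simp: k.le_less)
    obtain b where b: "b \<in> \<Gamma>" "c \<prec> b"
      using unb by blast
    note n = nxt[OF b]
    \<comment> \<open>No member of \<Gamma> lies after \<open>d\<close> and up to \<open>c\<close>,
      so all these points have the same next member.\<close>
    have "jumps_at \<Gamma> a = Some (wt (nxt \<Gamma> c) a)" if a: "d \<prec> a" "a \<preceq> c" for a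
    proof -
      have above: "c \<prec> e" if "e \<in> \<Gamma>" "a \<preceq> e" for e
      proof (rule ccontr)
        assume "\<not> c \<prec> e"
        then have "e \<prec> c"
          using False that(1) by (auto simp: k.not_less k.le_less)
        then have "e \<preceq> d"
          using d(1) that(1) by blast
        then show False
          using a(1) that(2) by (meson k.le_less_trans k.not_le k.order_trans)
      qed
      have "a \<notin> \<Gamma>"
        using above[of a] a(2) k.not_le by auto
      moreover have "a \<noteq> k0"
        using a(1) k0_le k.not_le by blast
      moreover have "nxt \<Gamma> a = nxt \<Gamma> c"
        using n a(2) above by (intro nxt_eqI) (auto intro: k.le_less_trans k.less_imp_le)
      ultimately show ?thesis
        by (simp add: jumps_at_def)
    qed
    moreover have "waits c (wt (nxt \<Gamma> c))"
      using n(2) by (intro waits_wt k.less_imp_le)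
    moreover have "jumps_at \<Gamma> d = None"
      using d_jump by (auto simp: jumps_at_def)
    ultimately show ?thesis
      unfolding okp_def using dc by blast
  qed
  then have "x \<in> branching"
    unfolding branching_def by blast
  then show ?thesis
    using x by blast
qed

text \<open>If no jump came after \<open>a\<close>, then beyond \<open>a\<close> each value would be
  taken fewer than \<nu> times on every initial segment, hence at most \<nu> times in all, and
  \<kappa> would have size at most \<nu>.\<close>

lemma branch_jumps_unbounded:
  assumes h: "\<And>c. okp x c h"
  shows "\<exists>c. a \<prec> c \<and> h c = None"
proof (rule ccontr)
  assume none: "\<not> ?thesis"
  have wait: "h c \<noteq> None" if "a \<prec> c" for c
    using none that by auto
  have init: "lt_nu {c. a \<prec> c \<and> c \<preceq> b \<and> h c = Some i}" for b i
  proof -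
    from last_jump[OF h[of b]] obtain u d where
      u: "waits b u" "h d = None" "\<And>c. d \<prec> c \<Longrightarrow> c \<preceq> b \<Longrightarrow> h c = Some (u c)"
      by blast
    have "d \<preceq> a"
      using wait[of d] u(2) k.not_le[of d a] by blast
    have "{c. a \<prec> c \<and> c \<preceq> b \<and> h c = Some i} \<subseteq> {c. c \<preceq> b \<and> u c = i}"
    proof (intro subsetI CollectI)
      fix c assume "c \<in> {c. a \<prec> c \<and> c \<preceq> b \<and> h c = Some i}"
      then show "c \<preceq> b \<and> u c = i"
        using u(3)[OF k.le_less_trans[OF \<open>d \<preceq> a\<close>], of c] by simp
    qed
    then show ?thesis
      using waits_fibres[OF u(1)] by (rule lt_nu_subset)
  qed
  \<comment> \<open>A larger fibre would have a subset of size \<nu>, which is bounded in \<kappa>,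
    contrary to \<open>init\<close>.\<close>
  have "le_nu {c. a \<prec> c \<and> h c = Some i}" for i
  proof (rule ccontr)
    assume "\<not> le_nu {c. a \<prec> c \<and> h c = Some i}"
    then have "|UNIV :: 'n set| \<le>o |{c. a \<prec> c \<and> h c = Some i}|"
      unfolding le_nu_iff using ordLeq_total[OF card_of_Well_order card_of_Well_order] by blast
    then obtain f :: "'n \<Rightarrow> 'k" where f: "inj f" "range f \<subseteq> {c. a \<prec> c \<and> h c = Some i}"
      unfolding card_of_ordLeq[symmetric] by blast
    obtain b where b: "\<forall>c\<in>range f. c \<prec> b"
      using k_bounded[OF le_nu_image[OF le_nu_UNIV]] by blast
    then have "range f \<subseteq> {c. a \<prec> c \<and> c \<preceq> b \<and> h c = Some i}"
      using f(2) k.less_imp_le by blast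
    then have "lt_nu (range f)"
      using init by (rule lt_nu_subset)
    then have "lt_nu (inv f ` range f)"
      by (rule lt_nu_image)
    then have "lt_nu (UNIV :: 'n set)"
      by (simp only: image_inv_f_f[OF f(1)])
    then show False
      unfolding lt_nu_iff using ordLess_irreflexive by blast
  qed
  then have "le_nu ((\<Union>i\<in>UNIV. {c. a \<prec> c \<and> h c = Some i}) \<union> {c. c \<preceq> a})"
    by (intro le_nu_Un le_nu_UN le_nu_UNIV le_nu_atMost)
  moreover have "(\<Union>i\<in>UNIV. {c. a \<prec> c \<and> h c = Some i}) \<union> {c. c \<preceq> a} = UNIV"
  proof (intro equalityI subset_UNIV subsetI)
    fix c
    show "c \<in> (\<Union>i\<in>UNIV. {c. a \<prec> c \<and> h c = Some i}) \<union> {c. c \<preceq> a}"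
      using wait[of c] k.not_le[of c a] by (cases "h c") auto
  qed
  ultimately show False
    using not_le_nu_UNIV by simp
qed

text \<open>Let \<open>x\<close> code on \<Gamma> a sequence that never jumps. The jumps of a branch
  are closed and unbounded, so one other than \<open>k0\<close> lies in \<Gamma>, where
  \<open>x\<close> would have to code a sequence jumping there.\<close>

lemma comeagre_meets_not_branching:
  fixes M :: "'k \<Rightarrow> ('k \<Rightarrow> 'k) set"
  assumes "\<And>a. nowhere_dense r (M a)"
  shows "\<exists>x \<in> Nb r b0 x0. x \<notin> branching \<and> (\<forall>a. x \<notin> M a)"
proof -
  obtain x \<Gamma> where x: "x \<in> Nb r b0 x0" "\<And>a. x \<notin> M a"
      and val: "\<And>c. c \<in> \<Gamma> \<Longrightarrow> x c = node c (\<lambda>_. Some undefined)"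
      and unb: "\<And>a. \<exists>c\<in>\<Gamma>. a \<prec> c"
      and closed: "\<And>c. c \<noteq> k0 \<Longrightarrow> (\<And>a. a \<prec> c \<Longrightarrow> \<exists>c'\<in>\<Gamma>. a \<prec> c' \<and> c' \<prec> c) \<Longrightarrow> c \<in> \<Gamma>"
    using ex_generic[where M = M and \<Phi> = "\<lambda>c G. node c (\<lambda>_. Some undefined)", OF assms] by blast
  have "x \<notin> branching"
  proof
    assume "x \<in> branching"
    then obtain h where h: "\<And>c. okp x c h"
      unfolding branching_def by blast
    obtain J where J: "\<And>a. a \<prec> J a" "\<And>a. h (J a) = None"
      using branch_jumps_unbounded[OF h] by metis
    obtain E where E: "\<And>a. a \<prec> E a" "\<And>a. E a \<in> \<Gamma>"
      using unb by metis
    have "\<exists>b. J a \<preceq> b \<and> E a \<preceq> b" for a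
      using k.linear k.order_refl by metis
    then obtain F where F: "\<And>a. J a \<preceq> F a" "\<And>a. E a \<preceq> F a"
      by metis
    \<comment> \<open>A closure point of \<open>F\<close> is a limit both of jumps of
      \<open>h\<close> and of members of \<Gamma>.\<close>
    obtain c where c: "k0 \<prec> c" "\<And>d. d \<prec> c \<Longrightarrow> F d \<prec> c"
      using ex_closed[of k0 F] by blast
    have "c \<in> \<Gamma>"
    proof (rule closed)
      show "c \<noteq> k0"
        using c(1) by auto
      show "\<exists>c'\<in>\<Gamma>. a \<prec> c' \<and> c' \<prec> c" if "a \<prec> c" for a
        using E[of a] F(2)[of a] c(2)[OF that] by (meson k.le_less_trans)
    qed
    then have xc: "x c = node c (\<lambda>_. Some undefined)"
      by (rule val)
    have "h c = None"
    proof (rule ccontr)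
      assume "h c \<noteq> None"
      with h[of c] obtain u d where d: "d \<prec> c" "\<And>a. d \<prec> a \<Longrightarrow> a \<preceq> c \<Longrightarrow> h a = Some (u a)"
        unfolding okp_def by blast
      have "J d \<preceq> c"
        using F(1)[of d] c(2)[OF d(1)] by (meson k.le_less_trans k.less_imp_le)
      then show False
        using d(2)[OF J(1)] J(2) by simp
    qed
    moreover have "x c = node c h"
      using jump_cases[OF h \<open>h c = None\<close>] c(1) by auto
    ultimately show False
      using xc by (auto simp: node_eq_iff)
  qed
  then show ?thesis
    using x by blast
qed

text \<open>If \<open>U\<close> is empty, \<open>branching\<close> would be \<kappa>-meagre;
  otherwise its complement would be \<kappa>-meagre in a basic open set. The two generic
  constructions exclude both.\<close>

lemma not_baire_branching: "\<not> kappa_baire r branching"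
proof
  assume "kappa_baire r branching"
  then obtain U and M :: "'k \<Rightarrow> ('k \<Rightarrow> 'k) set" where U: "kopen r U"
      and M: "\<And>a. nowhere_dense r (M a)" and sub: "(branching - U) \<union> (U - branching) \<subseteq> (\<Union>a. M a)"
    unfolding kappa_baire_def by blast
  show False
  proof (cases "U = {}")
    case True
    then show False
      using comeagre_meets_branching[where M = M, OF M, of k0 id] sub True by blast
  next
    case False
    then obtain f b where "Nb r b f \<subseteq> U"
      using U unfolding kopen_def by blast
    then show False
      using comeagre_meets_not_branching[where M = M, OF M, of b f] sub by blast
  qed
qed

end

theorem theorem1p10:
  fixes rn :: "('n \<times> 'n) set" and r :: "('k \<times> 'k) set"
  assumes nu_card: "card_order rn"
    and nu_inf: "infinite (UNIV :: 'n set)"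
    and nu_less: "ordIso2 (card_of {(x, f :: 'n \<Rightarrow> 'n). \<forall>y. y \<notin> underS rn x \<longrightarrow> f y = undefined})
                        (card_of (UNIV :: 'n set))"
    and kappa_card: "card_order r"
    and kappa_succ: "ordIso2 r (cardSuc rn)"
    and kappa_pow: "ordIso2 (card_of (UNIV :: 'k set)) (card_of (UNIV :: 'n set set))"
    and hyp: "\<forall>(T :: 'k set) lt. kappa_aronszajn r T lt
                 \<and> \<not> (\<exists>S \<subseteq> T. kappa_souslin r S (Restr lt S))
               \<longrightarrow> (\<exists>s :: 'k \<Rightarrow> 'n. \<forall>C \<subseteq> T. is_chain lt C \<longrightarrow> inj_on s C)"
  shows "\<exists>A :: ('k \<Rightarrow> 'k) set. Delta11 r A \<and> \<not> kappa_baire r A"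
proof -
  interpret nu_kappa rn r
    by unfold_locales (fact nu_card nu_inf nu_less kappa_card kappa_succ kappa_pow)+
  have "Delta11 r branching"
    unfolding Delta11_def using Sigma11_branching Sigma11_not_branching[OF hyp] by blast
  then show ?thesis
    using not_baire_branching by blast
qed

end
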